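(* Let $\Phi$, $\varphi$, $V$ be as in the standing assumption (see context), and suppose $\varphi\in\mathcal Z_{C_1}(\mathbb R^d)$ for some $C_1\in(0,1)$, with associated function $L_\varphi$. Suppose that there exist $\alpha\in(0,2)$ and a function $\ell$ slowly varying at zero such that $\Phi(u)\sim u^{\alpha/2}\ell(u)$ as $u\downarrow0$. If there exist (1) $C_2,C_3,M_1>0$ and $\kappa\in\left(0,\frac{d+\alpha}{2}\right)$ such that $C_2|x|^{-2\kappa}\le\varphi(x)\le C_3|x|^{-2\kappa}$ for $x\in B^c_{M_1}(0)$, (2) $M_2,C_4>0$ such that $L_\varphi(x)\le C_4|x|^{-(2\kappa+2)}$ for $x\in B^c_{M_2}(0)$, then $$V(x)=\begin{cases}O\big(|x|^{2\kappa-d-\alpha}\,\widetilde\ell(|x|^2)\big)&\text{if }\kappa\in\left(\frac d2,\frac{d+\alpha}2\right),\\ O\big(|x|^{-\alpha}\,\widetilde\ell(|x|^2)\big)&\text{if }\kappa\in\left(0,\frac d2\right),\\ O\big(|x|^{-\alpha}\log(|x|)\,\widetilde\ell(|x|^2)\big)&\text{if }\kappa=\frac d2,\end{cases}$$ where $\widetilde\ell(r)=\ell(1/r)$.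
   Context: Notation: $B_r(a)$ is the open ball in $\mathbb R^d$, $B_r^c(a)$ its complement; $D_hf(x)=f(x+h)-2f(x)+f(x-h)$. $V(x)=O(g(x))$ means there exist $R,C>0$ with $|V(x)|\le Cg(x)$ for $|x|\ge R$; $f\sim g$ means the ratio tends to $1$. A measurable $\ell:(0,\infty)\to(0,\infty)$ is slowly varying at zero if $\widetilde\ell(t)=\ell(1/t)$ satisfies $\lim_{t\to\infty}\widetilde\ell(ct)/\widetilde\ell(t)=1$ for every $c>0$. $\Phi$ is a complete Bernstein function with Lévy pair $(0,\mu)$: $\Phi(u)=\int_0^\infty(1-e^{-ut})\mu(t)\,dt$ with $\mu:(0,\infty)\to[0,\infty)$ completely monotone and $\int_0^\infty\min(1,t)\mu(t)\,dt<\infty$. The jump kernel is $j(r)=(4\pi)^{-d/2}\int_0^\infty t^{-d/2}e^{-r^2/(4t)}\mu(t)\,dt$, $r>0$. $\Phi(-\Delta)$ is the operator on $L^2(\mathbb R^d)$ with Fourier multiplier $\Phi(|y|^2)$. Standing assumption: $V:\mathbb R^d\to\mathbb R$ is a potential, $H=\Phi(-\Delta)+V$, and $\varphi\in L^2(\mathbb R^d)\cap L^\infty(\mathbb R^d)$, $\varphi>0$, satisfies $H\varphi=0$. The potential is understood through the pointwise expression $V(x)=-\frac{1}{\varphi(x)}\Phi(-\Delta)\varphi(x)=\frac{1}{2\varphi(x)}\int_{\mathbb R^d}D_h\varphi(x)\,j(|h|)\,dh$. Space: for $C\in(0,1)$, $\mathcal Z_C(\mathbb R^d)$ is the set of $f\in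 L^\infty(\mathbb R^d)$ for which there exist $M_f>0$ and $L_f\in L^\infty(B^c_{M_f}(0))$ such that $|D_hf(x)|\le L_f(x)|h|^2$ for all $x\in B^c_{M_f}(0)$ and $h\in B_{C|x|}(0)$. *)

theory Defs
  imports "HOL-Analysis.Analysis" "HOL-Library.Landau_Symbols"
begin

definition completely_monotone :: "(real \<Rightarrow> real) \<Rightarrow> bool" where
  "completely_monotone \<mu> \<longleftrightarrow>
     (\<forall>n. \<forall>t>0. (deriv ^^ n) \<mu> differentiable (at t) \<and> 0 \<le> (- 1) ^ n * (deriv ^^ n) \<mu> t)"

(* Complete Bernstein function without killing and drift; \<mu> is the Levy density. *)
definition complete_Bernstein_pair :: "(real \<Rightarrow> real) \<Rightarrow> (real \<Rightarrow> real) \<Rightarrow> bool" where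
  "complete_Bernstein_pair \<Phi> \<mu> \<longleftrightarrow>
     completely_monotone \<mu> \<and>
     set_integrable lborel {0<..} (\<lambda>t. min 1 t * \<mu> t) \<and>
     (\<forall>u>0. \<Phi> u = (LBINT t:{0<..}. (1 - exp (- (u * t))) * \<mu> t))"

definition jump_kernel :: "nat \<Rightarrow> (real \<Rightarrow> real) \<Rightarrow> real \<Rightarrow> real" where
  "jump_kernel d \<mu> r =
     (4 * pi) powr (- real d / 2) *
     (LBINT t:{0<..}. t powr (- real d / 2) * exp (- (r\<^sup>2 / (4 * t))) * \<mu> t)"

definition second_difference :: "'a::real_vector \<Rightarrow> ('a \<Rightarrow> real) \<Rightarrow> 'a \<Rightarrow> real" where
  "second_difference h f x = f (x + h) - 2 * f x + f (x - h)"

definition tilde :: "(real \<Rightarrow> real) \<Rightarrow> real \<Rightarrow> real" where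
  "tilde l r = l (1 / r)"

definition slowly_varying_at_zero :: "(real \<Rightarrow> real) \<Rightarrow> bool" where
  "slowly_varying_at_zero l \<longleftrightarrow>
     l \<in> borel_measurable (lebesgue_on {0<..}) \<and>
     (\<forall>t>0. 0 < l t) \<and>
     (\<forall>c>0. ((\<lambda>t. tilde l (c * t) / tilde l t) \<longlongrightarrow> 1) at_top)"

definition L1_fun :: "('a::euclidean_space \<Rightarrow> complex) \<Rightarrow> bool" where
  "L1_fun f \<longleftrightarrow> integrable lebesgue f"

definition L2_fun :: "('a::euclidean_space \<Rightarrow> complex) \<Rightarrow> bool" where
  "L2_fun f \<longleftrightarrow> f \<in> borel_measurable lebesgue \<and> integrable lebesgue (\<lambda>x. (norm (f x))\<^sup>2)"

definition Linf_on :: "'a::euclidean_space set \<Rightarrow> ('a \<Rightarrow> real) \<Rightarrow> bool" where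
  "Linf_on S f \<longleftrightarrow>
     f \<in> borel_measurable (lebesgue_on S) \<and> (\<exists>B. AE x in lebesgue_on S. \<bar>f x\<bar> \<le> B)"

definition fourier_integral :: "('a::euclidean_space \<Rightarrow> complex) \<Rightarrow> 'a \<Rightarrow> complex" where
  "fourier_integral f y =
     of_real ((2 * pi) powr (- real DIM('a) / 2)) *
     (LINT x|lebesgue. exp (- (\<i> * of_real (x \<bullet> y))) * f x)"

definition tends_in_L2 ::
    "(nat \<Rightarrow> 'a::euclidean_space \<Rightarrow> complex) \<Rightarrow> ('a \<Rightarrow> complex) \<Rightarrow> bool" where
  "tends_in_L2 s f \<longleftrightarrow>
     (\<lambda>n. \<integral>\<^sup>+ x. ennreal ((norm (s n x - f x))\<^sup>2) \<partial>lebesgue) \<longlonglongrightarrow> 0"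

(* F is the Fourier-Plancherel transform of f: the continuous extension to L2 of the unitarily
   normalised Fourier integral on the intersection of L1 and L2. *)
definition is_L2_fourier ::
    "('a::euclidean_space \<Rightarrow> complex) \<Rightarrow> ('a \<Rightarrow> complex) \<Rightarrow> bool" where
  "is_L2_fourier f F \<longleftrightarrow> L2_fun f \<and> L2_fun F \<and>
     (\<exists>s. (\<forall>n. L1_fun (s n) \<and> L2_fun (s n)) \<and>
          tends_in_L2 s f \<and> tends_in_L2 (\<lambda>n. fourier_integral (s n)) F)"

(* The graph of \<Phi>(-\<Delta>) on its maximal domain in L2: f is in the domain and is mapped to g
   (up to null sets). *)
definition Phi_Laplacian ::
    "(real \<Rightarrow> real) \<Rightarrow> ('a::euclidean_space \<Rightarrow> complex) \<Rightarrow> ('a \<Rightarrow> complex) \<Rightarrow> bool" where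
  "Phi_Laplacian \<Phi> f g \<longleftrightarrow>
     (\<exists>F. is_L2_fourier f F \<and> is_L2_fourier g (\<lambda>y. of_real (\<Phi> ((norm y)\<^sup>2)) * F y))"

(* f is in the kernel of \<Phi>(-\<Delta>) + V *)
definition H_null ::
    "(real \<Rightarrow> real) \<Rightarrow> ('a::euclidean_space \<Rightarrow> real) \<Rightarrow> ('a \<Rightarrow> real) \<Rightarrow> bool" where
  "H_null \<Phi> V f \<longleftrightarrow>
     (\<exists>g. Phi_Laplacian \<Phi> (\<lambda>x. complex_of_real (f x)) g \<and>
          (AE x in lebesgue. g x + complex_of_real (V x * f x) = 0))"

(* The Bochner integral of a non-integrable function is 0, so the identity is required only at
   points where the integral converges. *)
definition pointwise_potential ::
    "(real \<Rightarrow> real) \<Rightarrow> ('a::euclidean_space \<Rightarrow> real) \<Rightarrow> ('a \<Rightarrow> real) \<Rightarrow> bool" where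
  "pointwise_potential \<mu> V f \<longleftrightarrow>
     (\<forall>x. integrable lebesgue (\<lambda>h. second_difference h f x * jump_kernel DIM('a) \<mu> (norm h)) \<longrightarrow>
          V x = 1 / (2 * f x) *
            (LINT h|lebesgue. second_difference h f x * jump_kernel DIM('a) \<mu> (norm h)))"

definition standing_assumption ::
    "(real \<Rightarrow> real) \<Rightarrow> (real \<Rightarrow> real) \<Rightarrow> ('a::euclidean_space \<Rightarrow> real) \<Rightarrow> ('a \<Rightarrow> real) \<Rightarrow> bool" where
  "standing_assumption \<Phi> \<mu> V f \<longleftrightarrow>
     complete_Bernstein_pair \<Phi> \<mu> \<and>
     L2_fun (\<lambda>x. complex_of_real (f x)) \<and> Linf_on UNIV f \<and> (\<forall>x. 0 < f x) \<and>
     H_null \<Phi> V f \<and> pointwise_potential \<mu> V f"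

(* M and L are the number M_f and the function L_f in the definition of the space Z_C;
   only the values of L outside the ball of radius M matter. *)
definition Z_data ::
    "real \<Rightarrow> ('a::euclidean_space \<Rightarrow> real) \<Rightarrow> real \<Rightarrow> ('a \<Rightarrow> real) \<Rightarrow> bool" where
  "Z_data C f M L \<longleftrightarrow>
     0 < M \<and> Linf_on (- ball 0 M) L \<and>
     (\<forall>x \<in> - ball 0 M. \<forall>h \<in> ball 0 (C * norm x).
        \<bar>second_difference h f x\<bar> \<le> L x * (norm h)\<^sup>2)"

definition Z_space :: "real \<Rightarrow> ('a::euclidean_space \<Rightarrow> real) set" where
  "Z_space C = {f. Linf_on UNIV f \<and> (\<exists>M L. Z_data C f M L)}"

end

theory Submission
  imports Defs
begin

text \<open>
  Write \<open>r = norm x\<close>, \<open>R = C1 * r\<close> and \<open>d\<close> for the dimension. The jump kernel is a mixture of heat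
  kernels with weight \<open>\<mu>\<close>, and \<open>min 1 (t / R\<^sup>2)\<close> is comparable to \<open>1 - exp (- t / R\<^sup>2)\<close>. Hence every
  estimate of the heat kernel at time \<open>t\<close> that is proportional to \<open>min 1 (t / R\<^sup>2)\<close> integrates to an
  estimate of the jump kernel that is proportional to \<open>\<Phi> (1 / R\<^sup>2)\<close>. Two such estimates are enough:
  the integral of \<open>min 1 ((norm h)\<^sup>2 / R\<^sup>2)\<close> against the kernel is of order \<open>\<Phi> (1 / R\<^sup>2)\<close>
  (\<open>jump_kernel_truncated_moment\<close>), and outside the ball of radius \<open>R\<close> the kernel is at most of order
  \<open>\<Phi> (1 / R\<^sup>2)\<close> times \<open>R\<close> to the power \<open>- d\<close> (\<open>jump_kernel_le_Bernstein\<close>).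

  The integral defining \<open>V x\<close> is split into jumps shorter than \<open>R\<close>, where the second difference of
  \<open>\<phi>\<close> is small; longer jumps to points outside the ball of radius \<open>r\<close>, where \<open>\<phi>\<close> is at most of the
  order of \<open>\<phi> x\<close>; and longer jumps into that ball, where the kernel is bounded by its supremum and
  \<open>\<phi>\<close> contributes its mass \<open>I r\<close> in the ball. After division by \<open>\<phi> x\<close> the first two parts are of
  order \<open>\<Phi> (1 / R\<^sup>2)\<close> and the third is of that order times \<open>I r\<close> times \<open>r\<close> to the power \<open>2\<kappa> - d\<close>
  (\<open>potential_le_Bernstein_times_mass\<close>). By slow variation, \<open>\<Phi> (1 / R\<^sup>2)\<close> is at most of order
  \<open>tilde l (r\<^sup>2)\<close> times \<open>r\<close> to the power \<open>- \<alpha>\<close> (\<open>Bernstein_at_inverse_square_le\<close>).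

  The trichotomy is that of the mass of a function with decay exponent \<open>2\<kappa>\<close>: for \<open>2\<kappa> > d\<close> it stays
  bounded and the third part dominates, for \<open>2\<kappa> < d\<close> it grows like \<open>r\<close> to the power \<open>d - 2\<kappa>\<close> and all
  parts are of the same order, and for \<open>2\<kappa> = d\<close> it grows logarithmically.
\<close>

section \<open>Mass in balls of a function with power decay\<close>

text \<open>
  The shell between radii \<open>\<rho>\<close> and \<open>2\<rho>\<close> is charged the value of the majorant on its inner boundary
  times the volume of the outer ball; up to a constant that is the correct order, so summing over
  dyadic shells replaces integration in polar coordinates.
\<close>

lemma nn_integral_ball_doubling:
  fixes f :: "'a::euclidean_space \<Rightarrow> real"
  assumes [measurable]: "f \<in> borel_measurable lebesgue"
    and f: "\<And>x. 0 \<le> f x" "\<And>x. M \<le> norm x \<Longrightarrow> f x \<le> C * norm x powr (- s)"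
    and "0 < M" "0 \<le> C" "0 \<le> s" "M \<le> \<rho>"
  shows "(\<integral>\<^sup>+x. ennreal (f x) * indicator (ball 0 (2 * \<rho>)) x \<partial>lebesgue)
       \<le> (\<integral>\<^sup>+x. ennreal (f x) * indicator (ball 0 \<rho>) x \<partial>lebesgue)
         + ennreal (C * unit_ball_vol DIM('a) * 2 ^ DIM('a) * \<rho> powr (real DIM('a) - s))"
proof -
  have \<rho>: "0 < \<rho>" using assms by simp
  have "(\<integral>\<^sup>+x. ennreal (f x) * indicator (ball 0 (2 * \<rho>)) x \<partial>lebesgue)
      \<le> (\<integral>\<^sup>+x. ennreal (f x) * indicator (ball 0 \<rho>) x
            + ennreal (C * \<rho> powr (- s)) * indicator (ball 0 (2 * \<rho>)) x \<partial>lebesgue)"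
  proof (rule nn_integral_mono)
    fix x :: 'a
    have "f x \<le> C * \<rho> powr (- s)" if "\<rho> \<le> norm x"
    proof -
      have "f x \<le> C * norm x powr (- s)" using assms that by simp
      also have "\<dots> \<le> C * \<rho> powr (- s)" using that assms \<rho> by (intro mult_left_mono powr_mono2') auto
      finally show ?thesis .
    qed
    then show "ennreal (f x) * indicator (ball 0 (2 * \<rho>)) x
       \<le> ennreal (f x) * indicator (ball 0 \<rho>) x
          + ennreal (C * \<rho> powr (- s)) * indicator (ball 0 (2 * \<rho>)) x"
      using f(1)[of x] by (auto simp: indicator_def not_less intro!: ennreal_leI)
  qed
  also have "\<dots> = (\<integral>\<^sup>+x. ennreal (f x) * indicator (ball 0 \<rho>) x \<partial>lebesgue)
      + ennreal (C * \<rho> powr (- s)) * emeasure lborel (ball (0::'a) (2 * \<rho>))"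
    by (subst nn_integral_add)
      (simp_all add: nn_integral_cmult_indicator borel_measurable_times_ennreal borel_measurable_indicator)
  also have "emeasure lborel (ball (0::'a) (2 * \<rho>)) = ennreal (unit_ball_vol DIM('a) * (2 * \<rho>) ^ DIM('a))"
    using \<rho> by (intro emeasure_ball) auto
  also have "ennreal (C * \<rho> powr (- s)) * \<dots> =
       ennreal (C * \<rho> powr (- s) * (unit_ball_vol DIM('a) * (2 * \<rho>) ^ DIM('a)))"
    using assms by (intro ennreal_mult[symmetric]) auto
  also have "C * \<rho> powr (- s) * (unit_ball_vol DIM('a) * (2 * \<rho>) ^ DIM('a))
      = C * unit_ball_vol DIM('a) * 2 ^ DIM('a) * \<rho> powr (real DIM('a) - s)"
    using powr_add[of \<rho> "real DIM('a)" "- s"] \<rho>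
    by (simp add: power_mult_distrib powr_realpow mult_ac)
  finally show ?thesis .
qed

text \<open>
  The mass of \<open>f\<close> in the dyadic ball of index \<open>n\<close> is at most a geometric sum with ratio
  \<open>2\<close> to the power \<open>d - s\<close>. The three regimes below correspond to a ratio less than, greater than
  and equal to 1.
\<close>

lemma nn_integral_ball_dyadic:
  fixes f :: "'a::euclidean_space \<Rightarrow> real"
  assumes [measurable]: "f \<in> borel_measurable lebesgue"
    and f: "\<And>x. 0 \<le> f x" "\<And>x. M \<le> norm x \<Longrightarrow> f x \<le> C * norm x powr (- s)"
    and bdd: "AE x in lebesgue. f x \<le> B"
    and "0 < M" "0 \<le> C" "0 \<le> s"
  obtains A D where "0 \<le> A" "0 \<le> D"
    "\<And>n. (\<integral>\<^sup>+x. ennreal (f x) * indicator (ball 0 (2 ^ n * M)) x \<partial>lebesgue)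
       \<le> ennreal (A + D * (\<Sum>k<n. (2 powr (real DIM('a) - s)) ^ k))"
proof -
  define I where "I r = (\<integral>\<^sup>+x. ennreal (f x) * indicator (ball 0 r) x \<partial>lebesgue)" for r
  define q where "q = (2::real) powr (real DIM('a) - s)"
  define A where "A = \<bar>B\<bar> * (unit_ball_vol DIM('a) * M ^ DIM('a))"
  define D where "D = C * unit_ball_vol DIM('a) * 2 ^ DIM('a) * M powr (real DIM('a) - s)"
  have nn: "0 \<le> A" "0 \<le> D" using assms by (auto simp: A_def D_def)
  have "I (2 ^ n * M) \<le> ennreal (A + D * (\<Sum>k<n. q ^ k))" for n
  proof (induction n)
    case 0
    have "I M \<le> (\<integral>\<^sup>+x. ennreal \<bar>B\<bar> * indicator (ball (0::'a) M) x \<partial>lebesgue)"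
      unfolding I_def using bdd
      by (intro nn_integral_mono_AE, eventually_elim) (auto simp: indicator_def intro!: ennreal_leI)
    also have "\<dots> = ennreal \<bar>B\<bar> * emeasure lborel (ball (0::'a) M)"
      by (simp add: nn_integral_cmult_indicator)
    also have "\<dots> = ennreal A"
      using assms by (simp add: emeasure_ball A_def flip: ennreal_mult)
    finally show ?case by simp
  next
    case (Suc n)
    have M: "M \<le> 2 ^ n * M" using \<open>0 < M\<close> by simp
    have "I (2 ^ Suc n * M) \<le> I (2 ^ n * M)
       + ennreal (C * unit_ball_vol DIM('a) * 2 ^ DIM('a) * (2 ^ n * M) powr (real DIM('a) - s))"
      using nn_integral_ball_doubling[OF assms(1) f \<open>0 < M\<close> \<open>0 \<le> C\<close> \<open>0 \<le> s\<close> M]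
      by (simp add: I_def mult.assoc)
    also have "(2 ^ n * M) powr (real DIM('a) - s) = q ^ n * M powr (real DIM('a) - s)"
    proof -
      have "(2 ^ n) powr (real DIM('a) - s) = q ^ n"
        by (simp add: q_def powr_power powr_powr mult.commute flip: powr_realpow[of 2])
      then show ?thesis using \<open>0 < M\<close> by (subst powr_mult) auto
    qed
    also have "C * unit_ball_vol DIM('a) * 2 ^ DIM('a) * (q ^ n * M powr (real DIM('a) - s)) = D * q ^ n"
      by (simp add: D_def)
    also have "I (2 ^ n * M) + ennreal (D * q ^ n)
       \<le> ennreal (A + D * (\<Sum>k<n. q ^ k)) + ennreal (D * q ^ n)"
      by (intro add_right_mono Suc.IH)
    also have "\<dots> = ennreal (A + D * (\<Sum>k<Suc n. q ^ k))"
      using nn by (subst ennreal_plus[symmetric]) (auto simp: q_def algebra_simps intro!: add_nonneg_nonneg mult_nonneg_nonneg sum_nonneg)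
    finally show ?case .
  qed
  with nn show thesis using that by (auto simp: I_def q_def)
qed

lemma dyadic_radius:
  fixes M \<rho> :: real
  assumes "0 < M" "M \<le> \<rho>"
  obtains n :: nat where "\<rho> \<le> 2 ^ n * M" "2 ^ n * M \<le> 2 * \<rho>"
proof -
  define n where "n = (LEAST n. \<rho> \<le> 2 ^ n * M)"
  obtain m :: nat where "\<rho> / M < 2 ^ m" using real_arch_pow[of 2 "\<rho> / M"] by auto
  then have "\<rho> \<le> 2 ^ m * M" using assms by (simp add: field_simps)
  then have 1: "\<rho> \<le> 2 ^ n * M" unfolding n_def by (rule LeastI)
  have "2 ^ n * M \<le> 2 * \<rho>"
  proof (cases n)
    case 0
    then show ?thesis using assms by simp
  next
    case (Suc k)
    then have "\<not> \<rho> \<le> 2 ^ k * M" unfolding n_def by (intro not_less_Least) (simp add: n_def)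
    then show ?thesis using Suc by simp
  qed
  with 1 show thesis using that by blast
qed

lemma nn_integral_ball_mono:
  fixes r r' :: real and f :: "'a::euclidean_space \<Rightarrow> real"
  assumes "r \<le> r'"
  shows "(\<integral>\<^sup>+x. ennreal (f x) * indicator (ball 0 r) x \<partial>lebesgue)
       \<le> (\<integral>\<^sup>+x. ennreal (f x) * indicator (ball 0 r') x \<partial>lebesgue)"
  using assms by (intro nn_integral_mono) (auto simp: indicator_def)

lemma nn_integral_ball_fast_decay:
  fixes f :: "'a::euclidean_space \<Rightarrow> real"
  assumes "f \<in> borel_measurable lebesgue"
    and "\<And>x. 0 \<le> f x" "\<And>x. M \<le> norm x \<Longrightarrow> f x \<le> C * norm x powr (- s)"
    and "AE x in lebesgue. f x \<le> B"
    and "0 < M" "0 \<le> C" "real DIM('a) < s"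
  obtains K where "0 \<le> K"
    "\<And>\<rho>. (\<integral>\<^sup>+x. ennreal (f x) * indicator (ball 0 \<rho>) x \<partial>lebesgue) \<le> ennreal K"
proof -
  define q where "q = (2::real) powr (real DIM('a) - s)"
  have q: "0 < q" "q < 1" using assms by (auto simp: q_def powr_less_one)
  have "0 \<le> s" using assms by simp
  from nn_integral_ball_dyadic[OF assms(1-6) this] obtain A D where AD: "0 \<le> A" "0 \<le> D"
    "\<And>n. (\<integral>\<^sup>+x. ennreal (f x) * indicator (ball 0 (2 ^ n * M)) x \<partial>lebesgue)
       \<le> ennreal (A + D * (\<Sum>k<n. q ^ k))"
    unfolding q_def by blast
  have *: "(\<integral>\<^sup>+x. ennreal (f x) * indicator (ball 0 \<rho>) x \<partial>lebesgue) \<le> ennreal (A + D * (1 / (1 - q)))" for \<rho>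
  proof -
    obtain n where n: "max \<rho> M \<le> 2 ^ n * M" using dyadic_radius[OF \<open>0 < M\<close>, of "max \<rho> M"] by (metis max.cobounded2)
    have "(\<Sum>k<n. q ^ k) \<le> (\<Sum>k. q ^ k)"
      using q by (intro sum_le_suminf summable_geometric) auto
    also have "\<dots> = 1 / (1 - q)" using q by (simp add: suminf_geometric)
    finally have "A + D * (\<Sum>k<n. q ^ k) \<le> A + D * (1 / (1 - q))"
      using AD by (intro add_left_mono mult_left_mono)
    with AD(3)[of n] nn_integral_ball_mono[of \<rho> "2 ^ n * M" f] n show ?thesis
      by (meson ennreal_leI max.bounded_iff order_trans)
  qed
  show thesis by (rule that[OF _ *]) (use AD q in auto)
qed

lemma nn_integral_ball_slow_decay:
  fixes f :: "'a::euclidean_space \<Rightarrow> real"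
  assumes "f \<in> borel_measurable lebesgue"
    and "\<And>x. 0 \<le> f x" "\<And>x. M \<le> norm x \<Longrightarrow> f x \<le> C * norm x powr (- s)"
    and "AE x in lebesgue. f x \<le> B"
    and "0 < M" "0 \<le> C" "0 \<le> s" "s < real DIM('a)"
  obtains K where "0 \<le> K"
    "\<And>\<rho>. M \<le> \<rho> \<Longrightarrow> (\<integral>\<^sup>+x. ennreal (f x) * indicator (ball 0 \<rho>) x \<partial>lebesgue)
       \<le> ennreal (K * \<rho> powr (real DIM('a) - s))"
proof -
  define e where "e = real DIM('a) - s"
  define q where "q = (2::real) powr e"
  have e: "0 < e" using assms by (simp add: e_def)
  have q: "1 < q" using e by (simp add: q_def)
  from nn_integral_ball_dyadic[OF assms(1-7)] obtain A D where AD: "0 \<le> A" "0 \<le> D"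
    "\<And>n. (\<integral>\<^sup>+x. ennreal (f x) * indicator (ball 0 (2 ^ n * M)) x \<partial>lebesgue)
       \<le> ennreal (A + D * (\<Sum>k<n. q ^ k))"
    unfolding q_def e_def by blast
  define K where "K = (A + D / (q - 1) * 2 powr e) / M powr e"
  have *: "(\<integral>\<^sup>+x. ennreal (f x) * indicator (ball 0 \<rho>) x \<partial>lebesgue) \<le> ennreal (K * \<rho> powr e)"
    if "M \<le> \<rho>" for \<rho>
  proof -
    obtain n where n: "\<rho> \<le> 2 ^ n * M" "2 ^ n * M \<le> 2 * \<rho>" using dyadic_radius[OF \<open>0 < M\<close> \<open>M \<le> \<rho>\<close>] by blast
    have x: "1 \<le> (\<rho> / M) powr e" using that assms e by (intro ge_one_powr_ge_zero) auto
    have "q ^ n = (2 ^ n) powr e" by (simp add: q_def powr_power powr_powr mult.commute flip: powr_realpow[of 2])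
    also have "\<dots> \<le> (2 * (\<rho> / M)) powr e" using n assms e by (intro powr_mono2) (auto simp: field_simps)
    also have "\<dots> = 2 powr e * (\<rho> / M) powr e" using assms that by (intro powr_mult)
    finally have qn: "q ^ n \<le> 2 powr e * (\<rho> / M) powr e" .
    have "(\<Sum>k<n. q ^ k) = (q ^ n - 1) / (q - 1)" using q by (simp add: geometric_sum)
    also have "\<dots> \<le> (2 powr e * (\<rho> / M) powr e) / (q - 1)"
      using q qn by (intro divide_right_mono) auto
    finally have "A + D * (\<Sum>k<n. q ^ k) \<le> A * (\<rho> / M) powr e + D * ((2 powr e * (\<rho> / M) powr e) / (q - 1))"
      using AD x by (intro add_mono mult_left_mono) (auto simp: mult_le_cancel_left1)
    also have "\<dots> = K * \<rho> powr e"
      using assms that by (simp add: K_def powr_divide add_divide_distrib distrib_right distrib_left mult_ac)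
    finally show ?thesis using AD(3)[of n] nn_integral_ball_mono[of \<rho> "2 ^ n * M" f] n
      by (meson ennreal_leI order_trans)
  qed
  show thesis by (rule that[OF _ *[unfolded e_def]]) (use AD q in \<open>auto simp: K_def\<close>)
qed

text \<open>
  At the critical exponent every dyadic shell contributes the same mass, so the bound is the number of
  shells, which is logarithmic in the radius.
\<close>

lemma nn_integral_ball_critical_decay:
  fixes f :: "'a::euclidean_space \<Rightarrow> real"
  assumes "f \<in> borel_measurable lebesgue"
    and "\<And>x. 0 \<le> f x" "\<And>x. M \<le> norm x \<Longrightarrow> f x \<le> C * norm x powr (- real DIM('a))"
    and "AE x in lebesgue. f x \<le> B"
    and "0 < M" "0 \<le> C"
  obtains K where "0 \<le> K"
    "\<And>\<rho>. M \<le> \<rho> \<Longrightarrow> (\<integral>\<^sup>+x. ennreal (f x) * indicator (ball 0 \<rho>) x \<partial>lebesgue)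
       \<le> ennreal (K * (1 + ln (\<rho> / M)))"
proof -
  have geo: "(\<Sum>k<n. (2 powr (real DIM('a) - real DIM('a))) ^ k) = real n" for n :: nat
    by simp
  obtain A D where AD: "0 \<le> A" "0 \<le> D"
    "\<And>n. (\<integral>\<^sup>+x. ennreal (f x) * indicator (ball 0 (2 ^ n * M)) x \<partial>lebesgue)
       \<le> ennreal (A + D * real n)"
    by (rule nn_integral_ball_dyadic[OF assms(1-6) of_nat_0_le_iff, unfolded geo]) (assumption, rule that)
  define K where "K = A + 2 * D"
  have *: "(\<integral>\<^sup>+x. ennreal (f x) * indicator (ball 0 \<rho>) x \<partial>lebesgue) \<le> ennreal (K * (1 + ln (\<rho> / M)))"
    if "M \<le> \<rho>" for \<rho>
  proof -
    obtain n where n: "\<rho> \<le> 2 ^ n * M" "2 ^ n * M \<le> 2 * \<rho>" using dyadic_radius[OF \<open>0 < M\<close> \<open>M \<le> \<rho>\<close>] by blast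
    have l0: "0 \<le> ln (\<rho> / M)" using that assms by simp
    have "ln (2 ^ n) \<le> ln (2 * (\<rho> / M))" using n assms that by (subst ln_le_cancel_iff) (auto simp: field_simps)
    then have "real n * ln 2 \<le> ln 2 + ln (\<rho> / M)"
      using that assms by (subst (asm) ln_mult_pos) (auto simp: ln_realpow)
    moreover have "1 / 2 \<le> ln (2::real)" using ln2_ge_two_thirds by simp
    moreover have "real n \<le> 1 + ln (\<rho> / M) / ln 2" using calculation(1) by (simp add: field_simps)
    moreover have "ln (\<rho> / M) / ln 2 \<le> ln (\<rho> / M) / (1 / 2)" using l0 calculation(2) by (intro divide_left_mono) auto
    ultimately have "real n \<le> 2 * (1 + ln (\<rho> / M))" by simp
    then have "A + D * real n \<le> A * (1 + ln (\<rho> / M)) + D * (2 * (1 + ln (\<rho> / M)))"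
      using AD l0 by (intro add_mono mult_left_mono) (auto simp: mult_le_cancel_left1)
    also have "\<dots> = K * (1 + ln (\<rho> / M))" by (simp add: K_def algebra_simps)
    finally show ?thesis using AD(3)[of n] nn_integral_ball_mono[of \<rho> "2 ^ n * M" f] n
      by (meson ennreal_leI order_trans)
  qed
  show thesis by (rule that[OF _ *]) (use AD in \<open>auto simp: K_def\<close>)
qed

lemma nn_integral_finite_fast_decay:
  fixes f :: "'a::euclidean_space \<Rightarrow> real"
  assumes [measurable]: "f \<in> borel_measurable lebesgue"
    and "\<And>x. 0 \<le> f x" "\<And>x. M \<le> norm x \<Longrightarrow> f x \<le> C * norm x powr (- s)"
    and "AE x in lebesgue. f x \<le> B"
    and "0 < M" "0 \<le> C" "real DIM('a) < s"
  shows "(\<integral>\<^sup>+x. ennreal (f x) \<partial>lebesgue) < \<infinity>"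
proof -
  obtain K where K: "\<And>\<rho>. (\<integral>\<^sup>+x. ennreal (f x) * indicator (ball 0 \<rho>) x \<partial>lebesgue) \<le> ennreal K"
    using nn_integral_ball_fast_decay[OF assms] by metis
  have sup: "(SUP n. ennreal (f x) * indicator (ball 0 (real n)) x) = ennreal (f x)" for x
  proof (rule antisym)
    show "(SUP n. ennreal (f x) * indicator (ball 0 (real n)) x) \<le> ennreal (f x)"
      by (rule SUP_least) (auto simp: indicator_def)
    obtain n where "norm x < real n" using reals_Archimedean2 by blast
    then show "ennreal (f x) \<le> (SUP n. ennreal (f x) * indicator (ball 0 (real n)) x)"
      by (intro SUP_upper2[of n]) auto
  qed
  have "(\<integral>\<^sup>+x. ennreal (f x) \<partial>lebesgue)
      = (\<integral>\<^sup>+x. (SUP n. ennreal (f x) * indicator (ball 0 (real n)) x) \<partial>lebesgue)"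
    by (simp only: sup)
  also have "\<dots> = (SUP n. \<integral>\<^sup>+x. ennreal (f x) * indicator (ball 0 (real n)) x \<partial>lebesgue)"
  proof (rule nn_integral_monotone_convergence_SUP)
    show "incseq (\<lambda>n x. ennreal (f x) * indicator (ball 0 (real n)) x)"
      by (auto simp: incseq_def le_fun_def indicator_def)
    show "(\<lambda>x. ennreal (f x) * indicator (ball 0 (real n)) x) \<in> borel_measurable lebesgue" for n
      by (intro borel_measurable_times_ennreal borel_measurable_indicator) auto
  qed
  also have "\<dots> \<le> ennreal K" by (intro SUP_least K)
  also have "\<dots> < \<infinity>" by simp
  finally show ?thesis .
qed

section \<open>The Bernstein function as an integral of its Levy density\<close>

text \<open>
  With \<open>s = t / R\<^sup>2\<close>, this turns the truncated moments of the heat kernel at time \<open>t\<close> into the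
  integrand of the Bernstein function at \<open>1 / R\<^sup>2\<close>. \<close>

lemma min_one_le_exp:
  fixes s :: real
  assumes "0 \<le> s"
  shows "min 1 s \<le> 2 * (1 - exp (- s))"
proof (cases "s \<le> 1")
  case True
  have "1 + s \<le> exp s" by simp
  then have "exp (- s) \<le> 1 / (1 + s)" using assms by (simp add: exp_minus field_simps)
  moreover have "1 / (1 + s) \<le> 1 - s / 2"
    using assms True mult_left_mono[of s 1 s] by (simp add: field_simps)
  ultimately show ?thesis using True by simp
next
  case False
  have "exp (- s) \<le> exp (- 1)" using False by simp
  also have "exp (- 1) \<le> (1 / 2 :: real)" using exp_ge_add_one_self[of 1] by (simp add: exp_minus field_simps)
  finally show ?thesis using False by simp
qed

lemma one_minus_exp_le_min:
  fixes u t :: real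
  assumes "0 < u" "0 < t"
  shows "1 - exp (- (u * t)) \<le> max 1 u * min 1 t"
proof -
  have 1: "1 - exp (- (u * t)) \<le> u * t" using exp_ge_add_one_self[of "- (u * t)"] by simp
  have 2: "1 - exp (- (u * t)) \<le> 1" by simp
  show ?thesis
  proof (cases "t \<le> 1")
    case True
    have "u * t \<le> max 1 u * t" using assms by (intro mult_right_mono) auto
    with 1 True show ?thesis by (simp add: min_def)
  next
    case False
    then have "max 1 u * min 1 t = max 1 u" by simp
    moreover have "1 \<le> max 1 u" by simp
    ultimately show ?thesis using 2 by linarith
  qed
qed

lemma Levy_density_nonneg: "complete_Bernstein_pair \<Phi> \<mu> \<Longrightarrow> 0 < t \<Longrightarrow> 0 \<le> \<mu> t"
  unfolding complete_Bernstein_pair_def completely_monotone_def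
  by (metis (no_types, lifting) funpow_0 mult_1 power_0)

lemma Levy_density_measurable:
  assumes "complete_Bernstein_pair \<Phi> \<mu>"
  shows "(\<lambda>t. indicator {0<..} t * \<mu> t) \<in> borel_measurable borel"
proof -
  have "set_integrable lborel {0<..} (\<lambda>t. min 1 t * \<mu> t)"
    using assms by (simp add: complete_Bernstein_pair_def)
  then have [measurable]: "(\<lambda>t. indicator {0<..} t *\<^sub>R (min 1 t * \<mu> t)) \<in> borel_measurable borel"
    by (simp add: set_integrable_def borel_measurable_integrable flip: measurable_lborel2)
  have "(\<lambda>t. indicator {0<..} t * \<mu> t) = (\<lambda>t. indicator {0<..} t *\<^sub>R (min 1 t * \<mu> t) / min 1 t)"
    by (auto simp: fun_eq_iff indicator_def min_def)
  also have "\<dots> \<in> borel_measurable borel" by measurable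
  finally show ?thesis .
qed

lemma nn_integral_Bernstein:
  assumes B: "complete_Bernstein_pair \<Phi> \<mu>" and "0 < u"
  shows "(\<integral>\<^sup>+t. ennreal ((1 - exp (- (u * t))) * (indicator {0<..} t * \<mu> t)) \<partial>lborel) = ennreal (\<Phi> u)"
    and "0 \<le> \<Phi> u"
proof -
  let ?g = "\<lambda>t. (1 - exp (- (u * t))) * (indicator {0<..} t * \<mu> t)"
  note [measurable] = Levy_density_measurable[OF B]
  have int: "integrable lborel (\<lambda>t. indicator {0<..} t *\<^sub>R (min 1 t * \<mu> t))"
    using B by (simp add: complete_Bernstein_pair_def set_integrable_def)
  have nn: "0 \<le> ?g t" for t
    using assms Levy_density_nonneg[OF B, of t] by (auto simp: indicator_def)
  have "integrable lborel ?g"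
  proof (rule Bochner_Integration.integrable_bound)
    show "integrable lborel (\<lambda>t. max 1 u * (indicator {0<..} t *\<^sub>R (min 1 t * \<mu> t)))"
      using int by (intro integrable_mult_right)
    show "AE t in lborel. norm (?g t) \<le> norm (max 1 u * (indicator {0<..} t *\<^sub>R (min 1 t * \<mu> t)))"
    proof (rule AE_I2)
      fix t
      show "norm (?g t) \<le> norm (max 1 u * (indicator {0<..} t *\<^sub>R (min 1 t * \<mu> t)))"
      proof (cases "0 < t")
        case True
        have "(1 - exp (- (u * t))) * \<mu> t \<le> max 1 u * min 1 t * \<mu> t"
          using assms True Levy_density_nonneg[OF B True] by (intro mult_right_mono one_minus_exp_le_min) auto
        then show ?thesis using True nn[of t] by (simp add: mult.assoc)
      qed auto
    qed
  qed measurable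
  then have "(\<integral>\<^sup>+t. ennreal (?g t) \<partial>lborel) = ennreal (\<integral>t. ?g t \<partial>lborel)"
    using nn by (intro nn_integral_eq_integral) auto
  also have "(\<integral>t. ?g t \<partial>lborel) = \<Phi> u"
    using B \<open>0 < u\<close> by (simp add: complete_Bernstein_pair_def set_lebesgue_integral_def mult.left_commute)
  finally show "(\<integral>\<^sup>+t. ennreal (?g t) \<partial>lborel) = ennreal (\<Phi> u)" .
  have "0 \<le> (\<integral>t. ?g t \<partial>lborel)" using nn by (intro integral_nonneg_AE) auto
  then show "0 \<le> \<Phi> u" using \<open>(\<integral>t. ?g t \<partial>lborel) = \<Phi> u\<close> by simp
qed

lemma nn_integral_min_le_Bernstein:
  assumes B: "complete_Bernstein_pair \<Phi> \<mu>" and "0 < R"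
  shows "(\<integral>\<^sup>+t. ennreal (min 1 (t / R\<^sup>2) * (indicator {0<..} t * \<mu> t)) \<partial>lborel) \<le> ennreal (2 * \<Phi> (1 / R\<^sup>2))"
proof -
  note [measurable] = Levy_density_measurable[OF B]
  have "(\<integral>\<^sup>+t. ennreal (min 1 (t / R\<^sup>2) * (indicator {0<..} t * \<mu> t)) \<partial>lborel)
     \<le> (\<integral>\<^sup>+t. 2 * ennreal ((1 - exp (- (1 / R\<^sup>2 * t))) * (indicator {0<..} t * \<mu> t)) \<partial>lborel)"
  proof (rule nn_integral_mono)
    fix t
    show "ennreal (min 1 (t / R\<^sup>2) * (indicator {0<..} t * \<mu> t))
       \<le> 2 * ennreal ((1 - exp (- (1 / R\<^sup>2 * t))) * (indicator {0<..} t * \<mu> t))"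
    proof (cases "0 < t")
      case True
      then have "min 1 (t / R\<^sup>2) * \<mu> t \<le> 2 * (1 - exp (- (t / R\<^sup>2))) * \<mu> t"
        using Levy_density_nonneg[OF B True] by (intro mult_right_mono min_one_le_exp) auto
      then have "ennreal (min 1 (t / R\<^sup>2) * \<mu> t) \<le> ennreal (2 * ((1 - exp (- (t / R\<^sup>2))) * \<mu> t))"
        by (intro ennreal_leI) (simp only: mult.assoc)
      also have "\<dots> = 2 * ennreal ((1 - exp (- (t / R\<^sup>2))) * \<mu> t)" by (simp add: ennreal_mult')
      finally show ?thesis using True by simp
    qed auto
  qed
  also have "\<dots> = 2 * ennreal (\<Phi> (1 / R\<^sup>2))"
    using nn_integral_Bernstein(1)[OF B, of "1 / R\<^sup>2"] \<open>0 < R\<close> by (subst nn_integral_cmult) auto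
  finally show ?thesis by (simp add: ennreal_mult')
qed

section \<open>Bounds on the jump kernel in terms of the Bernstein function\<close>

text \<open>
  A non-integrable function has Bochner integral 0, so the inequality persists without integrability.
  Upper bounds on the jump kernel can therefore be derived before its convergence is known.
\<close>

lemma ennreal_integral_le_nn_integral:
  fixes g :: "'b \<Rightarrow> real"
  assumes "\<And>x. 0 \<le> g x"
  shows "ennreal (\<integral>x. g x \<partial>M) \<le> (\<integral>\<^sup>+x. ennreal (g x) \<partial>M)"
proof (cases "integrable M g")
  case True
  then show ?thesis using assms by (subst nn_integral_eq_integral) auto
qed (simp add: not_integrable_integral_eq)

lemma jump_kernel_nonneg:
  assumes B: "complete_Bernstein_pair \<Phi> \<mu>"
  shows "0 \<le> jump_kernel d \<mu> r"
  unfolding jump_kernel_def set_lebesgue_integral_def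
  using Levy_density_nonneg[OF B]
  by (intro mult_nonneg_nonneg integral_nonneg_AE AE_I2) (auto simp: indicator_def)

lemma jump_kernel_measurable:
  assumes B: "complete_Bernstein_pair \<Phi> \<mu>"
  shows "jump_kernel d \<mu> \<in> borel_measurable borel"
proof -
  note [measurable] = Levy_density_measurable[OF B]
  have "jump_kernel d \<mu> = (\<lambda>r. (4 * pi) powr (- real d / 2) *
     (\<integral>t. t powr (- real d / 2) * exp (- (r\<^sup>2 / (4 * t))) * (indicator {0<..} t * \<mu> t) \<partial>lborel))"
    by (simp add: fun_eq_iff jump_kernel_def set_lebesgue_integral_def mult_ac)
  also have "\<dots> \<in> borel_measurable borel" by measurable
  finally show ?thesis .
qed

lemma powr_times_exp_le:
  fixes w p :: real
  assumes "1 \<le> w" "p \<le> real n"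
  shows "w powr p * exp (- (w / 4)) \<le> 4 ^ n * fact n"
proof -
  have "w powr p \<le> w powr real n" using assms by (intro powr_mono) auto
  also have "\<dots> = w ^ n" using assms by (simp add: powr_realpow)
  finally have 1: "w powr p \<le> w ^ n" .
  have "(\<Sum>k\<in>{n}. inverse (fact k) * (w / 4) ^ k) \<le> (\<Sum>k. inverse (fact k) * (w / 4) ^ k)"
    using assms by (intro sum_le_suminf) (auto simp: summable_exp)
  also have "\<dots> = exp (w / 4)" by (simp add: exp_def scaleR_conv_of_real)
  finally have "(w / 4) ^ n \<le> fact n * exp (w / 4)" by (simp add: field_simps)
  then have "w ^ n \<le> 4 ^ n * fact n * exp (w / 4)"
    by (simp add: power_divide field_simps)
  with 1 have "w powr p \<le> 4 ^ n * fact n * exp (w / 4)" by simp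
  then have "w powr p * exp (- (w / 4)) \<le> 4 ^ n * fact n * exp (w / 4) * exp (- (w / 4))"
    by (intro mult_right_mono) auto
  also have "\<dots> = 4 ^ n * fact n" by (simp add: mult.assoc flip: exp_add)
  finally show ?thesis .
qed

text \<open>
  The normalising constant of the heat kernel is at most 1 and is dropped.
\<close>

lemma jump_kernel_le_nn_integral:
  assumes B: "complete_Bernstein_pair \<Phi> \<mu>"
  shows "ennreal (jump_kernel d \<mu> r) \<le>
    (\<integral>\<^sup>+t. ennreal (t powr (- real d / 2) * exp (- (r\<^sup>2 / (4 * t))) * (indicator {0<..} t * \<mu> t)) \<partial>lborel)"
proof -
  let ?g = "\<lambda>t. t powr (- real d / 2) * exp (- (r\<^sup>2 / (4 * t))) * (indicator {0<..} t * \<mu> t)"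
  have nn: "0 \<le> ?g t" for t using Levy_density_nonneg[OF B, of t] by (auto simp: indicator_def)
  have eq: "jump_kernel d \<mu> r = (4 * pi) powr (- real d / 2) * (\<integral>t. ?g t \<partial>lborel)"
    by (simp add: jump_kernel_def set_lebesgue_integral_def mult_ac)
  have "(4 * pi) powr (- real d / 2) \<le> (4 * pi) powr 0" using pi_gt3 by (intro powr_mono) auto
  then have "(4 * pi) powr (- real d / 2) \<le> 1" by simp
  then have "jump_kernel d \<mu> r \<le> 1 * (\<integral>t. ?g t \<partial>lborel)"
    unfolding eq using nn by (intro mult_right_mono integral_nonneg_AE) auto
  then have "ennreal (jump_kernel d \<mu> r) \<le> ennreal (\<integral>t. ?g t \<partial>lborel)" by (intro ennreal_leI) simp
  also have "\<dots> \<le> (\<integral>\<^sup>+t. ennreal (?g t) \<partial>lborel)" by (rule ennreal_integral_le_nn_integral[OF nn])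
  finally show ?thesis .
qed

text \<open>
  In the variable \<open>w = R\<^sup>2 / t\<close> the claim is scale-free. For small \<open>t\<close> the Gaussian factor beats every
  power of \<open>w\<close>, including the one extra power that produces \<open>t / R\<^sup>2\<close>; for large \<open>t\<close> the factor
  \<open>t\<close> to the power \<open>- d / 2\<close> alone suffices.
\<close>

lemma heat_kernel_off_ball_le:
  fixes t R r :: real
  assumes "0 < t" "0 < R" "R \<le> r"
  shows "t powr (- real d / 2) * exp (- (r\<^sup>2 / (4 * t)))
     \<le> 4 ^ (d + 1) * fact (d + 1) * R powr (- real d) * min 1 (t / R\<^sup>2)"
proof -
  define w where "w = R\<^sup>2 / t"
  have w: "0 < w" "t = R\<^sup>2 / w" using assms by (auto simp: w_def)
  define K :: real where "K = 4 ^ (d + 1) * fact (d + 1)"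
  have K: "1 \<le> K"
    unfolding K_def using one_le_power[of "4::real" "d + 1"] fact_ge_1[of "d + 1", where ?'a = real]
      mult_mono[of 1 "4 ^ (d + 1)" 1 "fact (d + 1) :: real"] by simp
  have "R\<^sup>2 \<le> r\<^sup>2" using assms by (intro power_mono) auto
  then have "R\<^sup>2 / (4 * t) \<le> r\<^sup>2 / (4 * t)" using assms by (intro divide_right_mono) auto
  moreover have "w / 4 = R\<^sup>2 / (4 * t)" by (simp add: w_def)
  ultimately have "exp (- (r\<^sup>2 / (4 * t))) \<le> exp (- (w / 4))" by simp
  then have e: "t powr (- real d / 2) * exp (- (r\<^sup>2 / (4 * t))) \<le> t powr (- real d / 2) * exp (- (w / 4))"
    by (intro mult_left_mono) auto
  have t: "t powr (- real d / 2) = (R\<^sup>2) powr (- real d / 2) * w powr (real d / 2)"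
    unfolding w(2) using w assms by (simp add: powr_divide powr_minus field_simps)
  have R: "(R\<^sup>2) powr (- real d / 2) = R powr (- real d)"
    using assms by (simp add: powr_powr flip: powr_numeral)
  have "R powr (- real d) * w powr (real d / 2) * exp (- (w / 4))
     \<le> R powr (- real d) * (K * min 1 (1 / w))"
  proof -
    have "w powr (real d / 2) * exp (- (w / 4)) \<le> K * min 1 (1 / w)"
    proof (cases "1 \<le> w")
      case True
      have "w powr (real d / 2 + 1) * exp (- (w / 4)) \<le> K"
        unfolding K_def using True by (intro powr_times_exp_le) auto
      moreover have "w powr (real d / 2 + 1) = w powr (real d / 2) * w" using w by (simp add: powr_add)
      ultimately have "w powr (real d / 2) * exp (- (w / 4)) \<le> K / w"
        using w(1) by (simp add: pos_le_divide_eq mult_ac)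
      moreover have "min 1 (1 / w) = 1 / w" using True by simp
      ultimately show ?thesis by simp
    next
      case False
      have "w powr (real d / 2) * exp (- (w / 4)) \<le> 1 * 1"
        using False w by (intro mult_mono powr_le1) auto
      then show ?thesis using False w K by (simp add: min_def field_simps)
    qed
    then show ?thesis by (simp add: mult.assoc mult_left_mono)
  qed
  then have "t powr (- real d / 2) * exp (- (r\<^sup>2 / (4 * t))) \<le> R powr (- real d) * (K * min 1 (1 / w))"
    by (intro order_trans[OF e]) (simp only: t R)
  then show ?thesis by (simp add: K_def w_def mult_ac)
qed

text \<open>
  Integrating the preceding heat kernel bound against the Levy density turns \<open>min 1 (t / R\<^sup>2)\<close> into
  \<open>\<Phi> (1 / R\<^sup>2)\<close>. The asymptotics of \<open>\<Phi>\<close> at 0 thereby give the decay of the kernel at infinity.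
\<close>

lemma jump_kernel_le_Bernstein:
  assumes B: "complete_Bernstein_pair \<Phi> \<mu>" and "0 < R" "R \<le> r"
  shows "jump_kernel d \<mu> r \<le> 2 * (4 ^ (d + 1) * fact (d + 1)) * R powr (- real d) * \<Phi> (1 / R\<^sup>2)"
proof -
  define c where "c = 4 ^ (d + 1) * fact (d + 1) * R powr (- real d)"
  have c: "0 \<le> c" by (simp add: c_def)
  note [measurable] = Levy_density_measurable[OF B]
  have \<Phi>: "0 \<le> \<Phi> (1 / R\<^sup>2)" using nn_integral_Bernstein(2)[OF B] assms by simp
  have "ennreal (jump_kernel d \<mu> r) \<le>
    (\<integral>\<^sup>+t. ennreal (t powr (- real d / 2) * exp (- (r\<^sup>2 / (4 * t))) * (indicator {0<..} t * \<mu> t)) \<partial>lborel)"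
    by (rule jump_kernel_le_nn_integral[OF B])
  also have "\<dots> \<le> (\<integral>\<^sup>+t. ennreal c * ennreal (min 1 (t / R\<^sup>2) * (indicator {0<..} t * \<mu> t)) \<partial>lborel)"
  proof (rule nn_integral_mono)
    fix t
    show "ennreal (t powr (- real d / 2) * exp (- (r\<^sup>2 / (4 * t))) * (indicator {0<..} t * \<mu> t))
      \<le> ennreal c * ennreal (min 1 (t / R\<^sup>2) * (indicator {0<..} t * \<mu> t))"
    proof (cases "0 < t")
      case True
      have "t powr (- real d / 2) * exp (- (r\<^sup>2 / (4 * t))) * \<mu> t \<le> c * min 1 (t / R\<^sup>2) * \<mu> t"
        unfolding c_def using assms True Levy_density_nonneg[OF B True]
        by (intro mult_right_mono heat_kernel_off_ball_le) auto
      then show ?thesis using True c by (simp add: mult.assoc ennreal_leI flip: ennreal_mult')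
    qed auto
  qed
  also have "\<dots> = ennreal c * (\<integral>\<^sup>+t. ennreal (min 1 (t / R\<^sup>2) * (indicator {0<..} t * \<mu> t)) \<partial>lborel)"
    by (intro nn_integral_cmult) measurable
  also have "\<dots> \<le> ennreal c * ennreal (2 * \<Phi> (1 / R\<^sup>2))"
    using assms by (intro mult_left_mono nn_integral_min_le_Bernstein) auto
  also have "\<dots> = ennreal (c * (2 * \<Phi> (1 / R\<^sup>2)))"
    using c by (simp add: ennreal_mult')
  finally have "jump_kernel d \<mu> r \<le> c * (2 * \<Phi> (1 / R\<^sup>2))"
    using c \<Phi> by (subst (asm) ennreal_le_iff) auto
  then show ?thesis by (simp add: c_def mult_ac)
qed

text \<open>
  The integrand decays faster than \<open>norm u\<close> to the power \<open>- (d + 1)\<close>, so the dyadic criterion applies.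
\<close>

lemma Gaussian_moment_finite:
  "(\<integral>\<^sup>+u. ennreal ((1 + (norm u)\<^sup>2) * exp (- ((norm u)\<^sup>2 / 4))) \<partial>(lborel :: 'a::euclidean_space measure)) < \<infinity>"
proof -
  let ?f = "\<lambda>u::'a. (1 + (norm u)\<^sup>2) * exp (- ((norm u)\<^sup>2 / 4))"
  (* Any exponent s above the dimension serves; n need only dominate 1 + s / 2. *)
  define n where "n = DIM('a) + 3"
  define s where "s = real DIM('a) + 1"
  have decay: "?f u \<le> 2 * (4 ^ n * fact n) * norm u powr (- s)" if "1 \<le> norm u" for u
  proof -
    let ?w = "(norm u)\<^sup>2"
    have w1: "1 \<le> ?w" using that by (simp add: one_le_power)
    have "norm u powr s = ?w powr (s / 2)" using that by (simp add: powr_powr flip: powr_numeral)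
    then have "?w * norm u powr s = ?w powr (1 + s / 2)" using w1 by (simp add: powr_add)
    moreover have "?w powr (1 + s / 2) * exp (- (?w / 4)) \<le> 4 ^ n * fact n"
      using w1 by (intro powr_times_exp_le) (auto simp: n_def s_def)
    ultimately have "2 * (?w * norm u powr s * exp (- (?w / 4))) \<le> 2 * (4 ^ n * fact n)" by simp
    moreover have "(1 + ?w) * (exp (- (?w / 4)) * norm u powr s) \<le> (2 * ?w) * (exp (- (?w / 4)) * norm u powr s)"
      using w1 by (intro mult_right_mono) auto
    ultimately have "?f u * norm u powr s \<le> 2 * (4 ^ n * fact n)" by (simp only: mult_ac)
    then have "?f u \<le> 2 * (4 ^ n * fact n) / norm u powr s"
      using that by (subst pos_le_divide_eq) auto
    then show ?thesis unfolding powr_minus divide_inverse .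
  qed
  have bdd: "?f u \<le> 2 + 2 * (4 ^ n * fact n)" for u
  proof (cases "1 \<le> norm u")
    case True
    have "norm u powr (- s) \<le> norm u powr 0" using True by (intro powr_mono) (auto simp: s_def)
    also have "\<dots> \<le> 1" using True by simp
    finally have "2 * (4 ^ n * fact n) * norm u powr (- s) \<le> 2 * (4 ^ n * fact n) * 1"
      by (intro mult_left_mono) auto
    with decay[OF True] show ?thesis by linarith
  next
    case False
    have "?f u \<le> (1 + 1\<^sup>2) * 1" using False by (intro mult_mono add_mono power_mono) auto
    also have "\<dots> \<le> 2 + 2 * (4 ^ n * fact n)" by simp
    finally show ?thesis .
  qed
  have "(\<integral>\<^sup>+u. ennreal (?f u) \<partial>lebesgue) < \<infinity>"
  proof (rule nn_integral_finite_fast_decay[where M = 1 and s = s and C = "2 * (4 ^ n * fact n)"])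
    show "?f \<in> borel_measurable lebesgue" by (intro measurable_completion) measurable
    show "AE u in lebesgue. ?f u \<le> 2 + 2 * (4 ^ n * fact n)" using bdd by (intro AE_I2)
  qed (use decay in \<open>auto simp: s_def\<close>)
  then show ?thesis by (simp add: nn_integral_completion)
qed

lemma nn_integral_lborel_dilation:
  fixes F :: "'a::euclidean_space \<Rightarrow> ennreal"
  assumes [measurable]: "F \<in> borel_measurable borel" and "0 < c"
  shows "(\<integral>\<^sup>+x. F x \<partial>lborel) = ennreal (c ^ DIM('a)) * (\<integral>\<^sup>+x. F (c *\<^sub>R x) \<partial>lborel)"
proof -
  have "(\<integral>\<^sup>+x. F x \<partial>lborel)
      = (\<integral>\<^sup>+x. F x \<partial>density (distr lborel borel (\<lambda>x::'a. 0 + c *\<^sub>R x)) (\<lambda>_. ennreal (\<bar>c\<bar> ^ DIM('a))))"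
    using lborel_affine[of c "0::'a"] assms by simp
  also have "\<dots> = ennreal (c ^ DIM('a)) * (\<integral>\<^sup>+x. F (c *\<^sub>R x) \<partial>lborel)"
    using assms by (simp add: nn_integral_density nn_integral_distr nn_integral_cmult)
  finally show ?thesis .
qed

text \<open>
  The dilation by \<open>sqrt t\<close> maps the heat kernel to a fixed Gaussian, and
  \<open>min 1 (q * p) \<le> min 1 q * (1 + p)\<close> separates \<open>q = t / R\<^sup>2\<close> from the space variable.
\<close>

lemma heat_kernel_truncated_moment:
  assumes "0 < t" "0 < R"
  shows "(\<integral>\<^sup>+h. ennreal (min 1 ((norm (h::'a::euclidean_space))\<^sup>2 / R\<^sup>2) *
            (t powr (- real DIM('a) / 2) * exp (- ((norm h)\<^sup>2 / (4 * t))))) \<partial>lborel)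
     \<le> (\<integral>\<^sup>+u. ennreal ((1 + (norm (u::'a))\<^sup>2) * exp (- ((norm u)\<^sup>2 / 4))) \<partial>lborel) * ennreal (min 1 (t / R\<^sup>2))"
proof -
  let ?F = "\<lambda>h::'a. min 1 ((norm h)\<^sup>2 / R\<^sup>2) *
            (t powr (- real DIM('a) / 2) * exp (- ((norm h)\<^sup>2 / (4 * t))))"
  let ?G = "\<lambda>u::'a. (1 + (norm u)\<^sup>2) * exp (- ((norm u)\<^sup>2 / 4))"
  have pw: "sqrt t ^ DIM('a) * ?F (sqrt t *\<^sub>R u) \<le> min 1 (t / R\<^sup>2) * ?G u" for u
  proof -
    have "sqrt t ^ DIM('a) * t powr (- real DIM('a) / 2) = 1"
      using assms by (simp add: powr_half_sqrt[symmetric] powr_power flip: powr_add)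
    then have "sqrt t ^ DIM('a) * ?F (sqrt t *\<^sub>R u)
        = min 1 (t * (norm u)\<^sup>2 / R\<^sup>2) * exp (- ((norm u)\<^sup>2 / 4))"
      using assms by (simp add: power_mult_distrib mult_ac)
    also have "min 1 (t * (norm u)\<^sup>2 / R\<^sup>2) \<le> min 1 (t / R\<^sup>2) * (1 + (norm u)\<^sup>2)"
    proof (cases "t / R\<^sup>2 \<le> 1")
      case True
      have "t * (norm u)\<^sup>2 / R\<^sup>2 = t / R\<^sup>2 * (norm u)\<^sup>2" by simp
      also have "\<dots> \<le> t / R\<^sup>2 * (1 + (norm u)\<^sup>2)" using assms by (intro mult_left_mono) auto
      finally show ?thesis using True by (simp add: min_def)
    next
      case False
      then have m: "min 1 (t / R\<^sup>2) = 1" by simp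
      have "min 1 (t * (norm u)\<^sup>2 / R\<^sup>2) \<le> 1" by (rule min.cobounded1)
      also have "1 \<le> 1 * (1 + (norm u)\<^sup>2)" by simp
      finally show ?thesis unfolding m .
    qed
    finally show ?thesis by (simp add: mult_right_mono mult.assoc)
  qed
  have "(\<integral>\<^sup>+h. ennreal (?F h) \<partial>lborel)
      = ennreal (sqrt t ^ DIM('a)) * (\<integral>\<^sup>+u. ennreal (?F (sqrt t *\<^sub>R u)) \<partial>lborel)"
    using assms by (intro nn_integral_lborel_dilation) auto
  also have "\<dots> = (\<integral>\<^sup>+u. ennreal (sqrt t ^ DIM('a) * ?F (sqrt t *\<^sub>R u)) \<partial>lborel)"
    using assms by (subst nn_integral_cmult[symmetric]) (auto simp: ennreal_mult')
  also have "\<dots> \<le> (\<integral>\<^sup>+u. ennreal (?G u) * ennreal (min 1 (t / R\<^sup>2)) \<partial>lborel)"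
  proof (rule nn_integral_mono)
    fix u :: 'a
    have "ennreal (sqrt t ^ DIM('a) * ?F (sqrt t *\<^sub>R u)) \<le> ennreal (?G u * min 1 (t / R\<^sup>2))"
      by (intro ennreal_leI order_trans[OF pw]) (simp add: mult_ac)
    also have "\<dots> = ennreal (?G u) * ennreal (min 1 (t / R\<^sup>2))"
      using assms by (intro ennreal_mult) auto
    finally show "ennreal (sqrt t ^ DIM('a) * ?F (sqrt t *\<^sub>R u)) \<le> ennreal (?G u) * ennreal (min 1 (t / R\<^sup>2))" .
  qed
  also have "\<dots> = (\<integral>\<^sup>+u. ennreal (?G u) \<partial>lborel) * ennreal (min 1 (t / R\<^sup>2))"
    by (intro nn_integral_multc) measurable
  finally show ?thesis .
qed

text \<open>
  This single estimate controls both the second moment of the kernel inside the ball of radius \<open>R\<close> and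
  its mass outside. The constant depends on the dimension only, so that \<open>R\<close> may later grow with the
  point at which the potential is evaluated.
\<close>

lemma jump_kernel_truncated_moment:
  obtains G where "0 \<le> G"
    "\<And>\<Phi> \<mu> R. complete_Bernstein_pair \<Phi> \<mu> \<Longrightarrow> 0 < R \<Longrightarrow>
      (\<integral>\<^sup>+h. ennreal (min 1 ((norm (h::'a::euclidean_space))\<^sup>2 / R\<^sup>2) * jump_kernel DIM('a) \<mu> (norm h)) \<partial>lborel)
        \<le> ennreal (G * \<Phi> (1 / R\<^sup>2))"
proof -
  define G0 where "G0 = (\<integral>\<^sup>+u. ennreal ((1 + (norm (u::'a))\<^sup>2) * exp (- ((norm u)\<^sup>2 / 4))) \<partial>lborel)"
  define g where "g = enn2real G0"
  have G0: "G0 = ennreal g" and g: "0 \<le> g"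
    using Gaussian_moment_finite[where ?'a = 'a] unfolding g_def G0_def[symmetric]
    by (auto simp: ennreal_enn2real_if)
  have "(\<integral>\<^sup>+h. ennreal (min 1 ((norm (h::'a))\<^sup>2 / R\<^sup>2) * jump_kernel DIM('a) \<mu> (norm h)) \<partial>lborel)
        \<le> ennreal (g * 2 * \<Phi> (1 / R\<^sup>2))"
    if B: "complete_Bernstein_pair \<Phi> \<mu>" and "0 < R" for \<Phi> \<mu> R
  proof -
    note [measurable] = Levy_density_measurable[OF B]
    let ?m = "\<lambda>t. indicator {0<..} t * \<mu> t"
    let ?k = "\<lambda>t r. t powr (- real DIM('a) / 2) * exp (- (r\<^sup>2 / (4 * t)))"
    have m: "0 \<le> ?m t" for t using Levy_density_nonneg[OF B, of t] by (auto simp: indicator_def)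
    have "(\<integral>\<^sup>+h. ennreal (min 1 ((norm (h::'a))\<^sup>2 / R\<^sup>2) * jump_kernel DIM('a) \<mu> (norm h)) \<partial>lborel)
       \<le> (\<integral>\<^sup>+h. \<integral>\<^sup>+t. ennreal (min 1 ((norm (h::'a))\<^sup>2 / R\<^sup>2) * ?k t (norm h)) * ennreal (?m t) \<partial>lborel \<partial>lborel)"
    proof (rule nn_integral_mono)
      fix h :: 'a
      have "ennreal (min 1 ((norm h)\<^sup>2 / R\<^sup>2) * jump_kernel DIM('a) \<mu> (norm h))
          \<le> ennreal (min 1 ((norm h)\<^sup>2 / R\<^sup>2)) * (\<integral>\<^sup>+t. ennreal (?k t (norm h) * ?m t) \<partial>lborel)"
        by (subst ennreal_mult', simp) (rule mult_left_mono[OF jump_kernel_le_nn_integral[OF B]], simp)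
      also have "\<dots> = (\<integral>\<^sup>+t. ennreal (min 1 ((norm h)\<^sup>2 / R\<^sup>2)) * ennreal (?k t (norm h) * ?m t) \<partial>lborel)"
        by (intro nn_integral_cmult[symmetric]) measurable
      also have "\<dots> = (\<integral>\<^sup>+t. ennreal (min 1 ((norm h)\<^sup>2 / R\<^sup>2) * ?k t (norm h)) * ennreal (?m t) \<partial>lborel)"
        using m by (intro nn_integral_cong) (simp add: mult_ac flip: ennreal_mult')
      finally show "ennreal (min 1 ((norm h)\<^sup>2 / R\<^sup>2) * jump_kernel DIM('a) \<mu> (norm h)) \<le> \<dots>" .
    qed
    also have "\<dots> = (\<integral>\<^sup>+t. \<integral>\<^sup>+h. ennreal (min 1 ((norm (h::'a))\<^sup>2 / R\<^sup>2) * ?k t (norm h)) * ennreal (?m t) \<partial>lborel \<partial>lborel)"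
      by (rule lborel_pair.Fubini') measurable
    also have "\<dots> \<le> (\<integral>\<^sup>+t. G0 * ennreal (min 1 (t / R\<^sup>2) * ?m t) \<partial>lborel)"
    proof (rule nn_integral_mono)
      fix t :: real
      show "(\<integral>\<^sup>+h. ennreal (min 1 ((norm (h::'a))\<^sup>2 / R\<^sup>2) * ?k t (norm h)) * ennreal (?m t) \<partial>lborel)
         \<le> G0 * ennreal (min 1 (t / R\<^sup>2) * ?m t)"
      proof (cases "0 < t")
        case True
        have "(\<integral>\<^sup>+h. ennreal (min 1 ((norm (h::'a))\<^sup>2 / R\<^sup>2) * ?k t (norm h)) * ennreal (?m t) \<partial>lborel)
          = (\<integral>\<^sup>+h. ennreal (min 1 ((norm (h::'a))\<^sup>2 / R\<^sup>2) * ?k t (norm h)) \<partial>lborel) * ennreal (?m t)"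
          by (intro nn_integral_multc) measurable
        also have "\<dots> \<le> G0 * ennreal (min 1 (t / R\<^sup>2)) * ennreal (?m t)"
          unfolding G0_def using True \<open>0 < R\<close> by (intro mult_right_mono heat_kernel_truncated_moment) auto
        also have "\<dots> = G0 * ennreal (min 1 (t / R\<^sup>2) * ?m t)"
          using True by (simp add: mult.assoc ennreal_mult')
        finally show ?thesis .
      qed auto
    qed
    also have "\<dots> = G0 * (\<integral>\<^sup>+t. ennreal (min 1 (t / R\<^sup>2) * ?m t) \<partial>lborel)"
      by (intro nn_integral_cmult) measurable
    also have "\<dots> \<le> G0 * ennreal (2 * \<Phi> (1 / R\<^sup>2))"
      using \<open>0 < R\<close> B by (intro mult_left_mono nn_integral_min_le_Bernstein) auto
    also have "\<dots> = ennreal (g * 2 * \<Phi> (1 / R\<^sup>2))"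
      using g by (simp add: G0 mult.assoc flip: ennreal_mult')
    finally show ?thesis .
  qed
  then show thesis by (rule that[of "g * 2", rotated]) (use g in auto)
qed

section \<open>Integrals of second differences against a kernel\<close>

lemma
  fixes x :: "'a::euclidean_space"
  assumes "\<bar>c\<bar> = 1"
  shows lebesgue_measurable_reflect_translate: "(\<lambda>h. x + c *\<^sub>R h) \<in> lebesgue \<rightarrow>\<^sub>M lebesgue"
    and nn_integral_reflect_translate: "\<And>f. f \<in> borel_measurable lebesgue \<Longrightarrow>
      (\<integral>\<^sup>+h. f (x + c *\<^sub>R h) \<partial>lebesgue) = (\<integral>\<^sup>+y. f y \<partial>lebesgue)"
proof -
  have c: "c \<noteq> 0" using assms by auto
  have T: "(\<lambda>h::'a. x + (\<Sum>j\<in>Basis. (c * (h \<bullet> j)) *\<^sub>R j)) = (\<lambda>h. x + c *\<^sub>R h)"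
    by (simp add: fun_eq_iff euclidean_representation flip: scaleR_scaleR scaleR_sum_right)
  show m[measurable]: "(\<lambda>h. x + c *\<^sub>R h) \<in> lebesgue \<rightarrow>\<^sub>M lebesgue"
    using lebesgue_affine_measurable[of "\<lambda>_::'a. c" x] c by (simp add: T)
  have eq: "lebesgue = density (distr lebesgue lebesgue (\<lambda>h. x + c *\<^sub>R h)) (\<lambda>_. 1)"
    using lebesgue_affine_euclidean[of "\<lambda>_::'a. c" x] c assms by (simp add: T)
  fix f :: "'a \<Rightarrow> ennreal" assume [measurable]: "f \<in> borel_measurable lebesgue"
  have "(\<integral>\<^sup>+y. f y \<partial>lebesgue) = (\<integral>\<^sup>+y. f y \<partial>distr lebesgue lebesgue (\<lambda>h. x + c *\<^sub>R h))"
    by (subst eq) (simp add: density_1)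
  also have "\<dots> = (\<integral>\<^sup>+h. f (x + c *\<^sub>R h) \<partial>lebesgue)"
    by (rule nn_integral_distr) measurable
  finally show "(\<integral>\<^sup>+h. f (x + c *\<^sub>R h) \<partial>lebesgue) = (\<integral>\<^sup>+y. f y \<partial>lebesgue)" ..
qed

text \<open>
  Think of \<open>J\<close> as a jump kernel: \<open>R\<close> separates small from large jumps, and \<open>r\<close> is the radius of a
  central ball outside which \<open>f\<close> is no larger than the bound \<open>b\<close> for its value at the base point.
  Small jumps use the bound on the second difference. For a large jump to a point \<open>y\<close> there are two
  cases: if \<open>y\<close> lies outside the central ball, then \<open>f y \<le> b\<close> and the tail of \<open>J\<close> is integrated; if \<open>y\<close> lies in the central ball, where \<open>f\<close> may be large, the supremum \<open>S\<close> of \<open>J\<close> over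
  large jumps is multiplied by the mass of \<open>f\<close> in that ball.
\<close>

lemma integral_second_difference_bound:
  fixes f J :: "'a::euclidean_space \<Rightarrow> real"
  assumes f[measurable]: "f \<in> borel_measurable lebesgue" and f0: "\<And>y. 0 \<le> f y"
    and J: "J \<in> borel_measurable borel" and J0: "\<And>h. 0 \<le> J h"
    and "0 < R" "0 \<le> a" "0 \<le> S" "0 \<le> I" "0 \<le> m"
    and near: "\<And>h. norm h < R \<Longrightarrow> \<bar>second_difference h f x\<bar> \<le> a * ((norm h)\<^sup>2 / R\<^sup>2)"
    and fx: "f x \<le> b" and far: "\<And>y. r \<le> norm y \<Longrightarrow> f y \<le> b"
    and JS: "\<And>h. R \<le> norm h \<Longrightarrow> J h \<le> S"
    and mass: "(\<integral>\<^sup>+y. ennreal (f y) * indicator (ball 0 r) y \<partial>lebesgue) \<le> ennreal I"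
    and moment: "(\<integral>\<^sup>+h. ennreal (min 1 ((norm h)\<^sup>2 / R\<^sup>2) * J h) \<partial>lborel) \<le> ennreal m"
  shows "integrable lebesgue (\<lambda>h. second_difference h f x * J h)"
    and "\<bar>LINT h|lebesgue. second_difference h f x * J h\<bar> \<le> (a + 4 * b) * m + 2 * (S * I)"
proof -
  let ?g = "\<lambda>h. second_difference h f x * J h"
  let ?k = "\<lambda>h. min 1 ((norm h)\<^sup>2 / R\<^sup>2) * J h"
  let ?p = "\<lambda>y. ennreal (f y) * indicator (ball 0 r) y"
  have b: "0 \<le> b" using fx f0[of x] by simp
  have Jl: "J \<in> borel_measurable lebesgue" using J by (intro measurable_completion) simp
  have tm: "(\<lambda>h. f (x + c *\<^sub>R h)) \<in> borel_measurable lebesgue" if "\<bar>c\<bar> = 1" for c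
    using measurable_compose[OF lebesgue_measurable_reflect_translate[OF that] f] .
  have m1: "(\<lambda>h. f (x + h)) \<in> borel_measurable lebesgue" "(\<lambda>h. f (x - h)) \<in> borel_measurable lebesgue"
    using tm[of 1] tm[of "-1"] by simp_all
  have gm: "?g \<in> borel_measurable lebesgue"
    unfolding second_difference_def using m1 Jl by measurable
  have pm[measurable]: "?p \<in> borel_measurable lebesgue"
    by (intro borel_measurable_times_ennreal borel_measurable_indicator) auto
  have pm': "(\<lambda>h. ?p (x + c *\<^sub>R h)) \<in> borel_measurable lebesgue" if "\<bar>c\<bar> = 1" for c
    using measurable_compose[OF lebesgue_measurable_reflect_translate[OF that] pm] .
  have km: "(\<lambda>h. ennreal (?k h)) \<in> borel_measurable lebesgue"
  proof -
    note [measurable] = J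
    show ?thesis by (intro measurable_completion) measurable
  qed
  have far_J: "ennreal (f y * J h) \<le> ennreal (b * ?k h) + ennreal S * ?p y" if "R \<le> norm h" for y h
  proof -
    have "R\<^sup>2 \<le> (norm h)\<^sup>2" using that \<open>0 < R\<close> by (intro power_mono) auto
    then have k: "?k h = J h" using \<open>0 < R\<close> by simp
    show ?thesis
    proof (cases "norm y < r")
      case True
      have "f y * J h \<le> S * f y"
        using JS[OF that] f0[of y] by (simp add: mult.commute mult_right_mono)
      then have "ennreal (f y * J h) \<le> ennreal S * ?p y"
        using True \<open>0 \<le> S\<close> by (simp add: ennreal_leI flip: ennreal_mult')
      then show ?thesis by (simp add: add_increasing)
    next
      case False
      then have "f y * J h \<le> b * J h" using far J0 by (intro mult_right_mono) auto
      then show ?thesis unfolding k using False by (simp add: ennreal_leI)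
    qed
  qed
  have pw: "ennreal \<bar>?g h\<bar> \<le> ennreal (a + 4 * b) * ennreal (?k h) + ennreal S * ?p (x + 1 *\<^sub>R h) + ennreal S * ?p (x + (- 1) *\<^sub>R h)"
    for h
  proof (cases "norm h < R")
    case True
    have "(norm h)\<^sup>2 \<le> R\<^sup>2" using True by (intro power_mono) auto
    then have k: "?k h = (norm h)\<^sup>2 / R\<^sup>2 * J h" using \<open>0 < R\<close> by (simp add: min_absorb2)
    have k0: "0 \<le> ?k h" using J0 by simp
    have "\<bar>?g h\<bar> \<le> a * ((norm h)\<^sup>2 / R\<^sup>2) * J h"
      using near[OF True] J0[of h] by (simp add: abs_mult mult_right_mono del: times_divide_eq_right)
    also have "\<dots> = a * ?k h" by (simp add: k)
    also have "\<dots> \<le> (a + 4 * b) * ?k h" using b k0 by (intro mult_right_mono) auto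
    finally have "ennreal \<bar>?g h\<bar> \<le> ennreal ((a + 4 * b) * ?k h)" by (rule ennreal_leI)
    also have "\<dots> = ennreal (a + 4 * b) * ennreal (?k h)"
      using b \<open>0 \<le> a\<close> by (intro ennreal_mult') auto
    finally show ?thesis by (simp add: add_increasing2 add.assoc)
  next
    case False
    then have hR: "R \<le> norm h" by simp
    have "R\<^sup>2 \<le> (norm h)\<^sup>2" using hR \<open>0 < R\<close> by (intro power_mono) auto
    then have k: "?k h = J h" using \<open>0 < R\<close> by simp
    have nn: "0 \<le> f y * J h" for y using f0 J0 by simp
    have "\<bar>second_difference h f x\<bar> \<le> 2 * b + f (x + h) + f (x - h)"
      using f0[of x] f0[of "x + h"] f0[of "x - h"] fx unfolding second_difference_def by linarith
    then have "\<bar>?g h\<bar> \<le> (2 * b + f (x + h) + f (x - h)) * J h"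
      using J0[of h] by (simp add: abs_mult mult_right_mono)
    also have "\<dots> = 2 * b * ?k h + f (x + h) * J h + f (x - h) * J h"
      unfolding k by (simp add: distrib_right)
    finally have "ennreal \<bar>?g h\<bar> \<le> ennreal (2 * b * ?k h + f (x + h) * J h + f (x - h) * J h)"
      by (rule ennreal_leI)
    also have "\<dots> = ennreal (2 * b * ?k h) + ennreal (f (x + h) * J h) + ennreal (f (x - h) * J h)"
      using nn b J0[of h] unfolding k by (simp add: ennreal_plus)
    also have "\<dots> \<le> ennreal (2 * b * ?k h) + (ennreal (b * ?k h) + ennreal S * ?p (x + h))
         + (ennreal (b * ?k h) + ennreal S * ?p (x - h))"
      by (intro add_mono far_J hR order_refl)
    also have "\<dots> = (ennreal (2 * b * ?k h) + ennreal (b * ?k h) + ennreal (b * ?k h))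
         + ennreal S * ?p (x + h) + ennreal S * ?p (x - h)"
      by (simp only: add_ac)
    also have "ennreal (2 * b * ?k h) + ennreal (b * ?k h) + ennreal (b * ?k h) = ennreal (4 * b * ?k h)"
      using b J0[of h] unfolding k by (simp flip: ennreal_plus)
    also have "\<dots> \<le> ennreal ((a + 4 * b) * ?k h)"
      using \<open>0 \<le> a\<close> J0[of h] unfolding k by (intro ennreal_leI mult_right_mono) auto
    also have "\<dots> = ennreal (a + 4 * b) * ennreal (?k h)"
      using b \<open>0 \<le> a\<close> by (intro ennreal_mult') auto
    finally show ?thesis by (simp add: add_right_mono)
  qed
  have "(\<integral>\<^sup>+h. ennreal (norm (?g h)) \<partial>lebesgue)
     \<le> (\<integral>\<^sup>+h. ennreal (a + 4 * b) * ennreal (?k h) + ennreal S * ?p (x + 1 *\<^sub>R h)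
          + ennreal S * ?p (x + (- 1) *\<^sub>R h) \<partial>lebesgue)"
    unfolding real_norm_def by (intro nn_integral_mono pw)
  also have "\<dots> = ennreal (a + 4 * b) * (\<integral>\<^sup>+h. ennreal (?k h) \<partial>lebesgue)
      + ennreal S * (\<integral>\<^sup>+h. ?p (x + 1 *\<^sub>R h) \<partial>lebesgue) + ennreal S * (\<integral>\<^sup>+h. ?p (x + (- 1) *\<^sub>R h) \<partial>lebesgue)"
    using km pm'[of 1] pm'[of "- 1"] by (simp only: nn_integral_add nn_integral_cmult borel_measurable_add
        borel_measurable_times_ennreal borel_measurable_const abs_one abs_minus_cancel)
  also have "\<dots> = ennreal (a + 4 * b) * (\<integral>\<^sup>+h. ennreal (?k h) \<partial>lborel)
      + ennreal S * (\<integral>\<^sup>+y. ?p y \<partial>lebesgue) + ennreal S * (\<integral>\<^sup>+y. ?p y \<partial>lebesgue)"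
    using nn_integral_reflect_translate[OF _ pm, of 1 x] nn_integral_reflect_translate[OF _ pm, of "- 1" x]
    by (simp only: nn_integral_completion abs_one abs_minus_cancel)
  also have "\<dots> \<le> ennreal (a + 4 * b) * ennreal m + ennreal S * ennreal I + ennreal S * ennreal I"
    by (intro add_mono mult_left_mono moment mass) auto
  also have "\<dots> = ennreal ((a + 4 * b) * m) + ennreal (S * I) + ennreal (S * I)"
    using assms(6-9) b by (simp add: ennreal_mult')
  also have "\<dots> = ennreal ((a + 4 * b) * m + S * I + S * I)"
    using assms(6-9) b by (simp flip: ennreal_plus)
  finally have bound: "(\<integral>\<^sup>+h. ennreal (norm (?g h)) \<partial>lebesgue) \<le> ennreal ((a + 4 * b) * m + S * I + S * I)" .
  show int: "integrable lebesgue ?g"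
    using gm bound by (intro integrableI_bounded) (auto intro: le_less_trans)
  have "ennreal (norm (LINT h|lebesgue. ?g h)) \<le> (\<integral>\<^sup>+h. ennreal (norm (?g h)) \<partial>lebesgue)"
    using int by (rule integral_norm_bound_ennreal)
  also note bound
  finally show "\<bar>LINT h|lebesgue. ?g h\<bar> \<le> (a + 4 * b) * m + 2 * (S * I)"
    using assms(6-9) b by (subst (asm) ennreal_le_iff) (auto simp: mult_ac)
qed

section \<open>Growth of the potential\<close>

text \<open>
  Slow variation removes the factor \<open>C\<close> from the argument of \<open>tilde l\<close>. The 4 is a factor 2 for that
  limit times a factor 2 for the asymptotic equivalence, since both ratios are eventually below 2.
\<close>

lemma Bernstein_at_inverse_square_le:
  assumes "0 < C" and sv: "slowly_varying_at_zero l"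
    and asym: "\<Phi> \<sim>[at_right 0] (\<lambda>u. u powr (\<alpha> / 2) * l u)"
  shows "\<forall>\<^sub>F r in at_top. \<Phi> (1 / (C * r)\<^sup>2) \<le> 4 * C powr (- \<alpha>) * (r powr (- \<alpha>) * tilde l (r\<^sup>2))"
proof -
  have lpos: "0 < l t" if "0 < t" for t using sv that by (simp add: slowly_varying_at_zero_def)
  have "((\<lambda>u. if \<Phi> u = 0 \<and> u powr (\<alpha> / 2) * l u = 0 then 1 else \<Phi> u / (u powr (\<alpha> / 2) * l u)) \<longlongrightarrow> 1) (at_right 0)"
    using asymp_equivD[OF asym] .
  then have "\<forall>\<^sub>F u in at_right 0. (if \<Phi> u = 0 \<and> u powr (\<alpha> / 2) * l u = 0 then 1 else \<Phi> u / (u powr (\<alpha> / 2) * l u)) < 2"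
    by (rule order_tendstoD) simp
  then have 1: "\<forall>\<^sub>F u in at_right 0. \<Phi> u \<le> 2 * (u powr (\<alpha> / 2) * l u)"
    using eventually_at_right_less[of 0]
  proof eventually_elim
    case (elim u)
    then have "0 < u powr (\<alpha> / 2) * l u" using lpos by simp
    with elim(1) show ?case by (simp add: pos_divide_less_eq split: if_splits)
  qed
  have lim: "filterlim (\<lambda>r::real. 1 / (C * r)\<^sup>2) (at_right 0) at_top"
  proof -
    have "filterlim (\<lambda>r. (C * r)\<^sup>2) at_top at_top"
      using \<open>0 < C\<close> by (intro filterlim_pow_at_top filterlim_tendsto_pos_mult_at_top[OF tendsto_const]
          filterlim_ident) auto
    from filterlim_compose[OF filterlim_inverse_at_right_top this] show ?thesis
      by (simp add: divide_inverse)
  qed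
  have 2: "\<forall>\<^sub>F r in at_top. \<Phi> (1 / (C * r)\<^sup>2) \<le> 2 * ((1 / (C * r)\<^sup>2) powr (\<alpha> / 2) * l (1 / (C * r)\<^sup>2))"
    using eventually_compose_filterlim[OF 1 lim] .
  have "((\<lambda>t. tilde l (C\<^sup>2 * t) / tilde l t) \<longlongrightarrow> 1) at_top"
    using sv \<open>0 < C\<close> by (simp add: slowly_varying_at_zero_def)
  then have "\<forall>\<^sub>F t in at_top. tilde l (C\<^sup>2 * t) / tilde l t < 2"
    by (rule order_tendstoD) simp
  moreover have "filterlim (\<lambda>r::real. r\<^sup>2) at_top at_top" by (intro filterlim_pow_at_top filterlim_ident) auto
  ultimately have 3: "\<forall>\<^sub>F r in at_top. tilde l (C\<^sup>2 * r\<^sup>2) / tilde l (r\<^sup>2) < 2"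
    using eventually_compose_filterlim by fast
  show ?thesis
    using 2 3 eventually_gt_at_top[of 0]
  proof eventually_elim
    case (elim r)
    have t: "0 < tilde l (r\<^sup>2)" using lpos elim by (simp add: tilde_def)
    then have "tilde l (C\<^sup>2 * r\<^sup>2) \<le> 2 * tilde l (r\<^sup>2)" using elim by (simp add: pos_divide_less_eq)
    moreover have "l (1 / (C * r)\<^sup>2) = tilde l (C\<^sup>2 * r\<^sup>2)" by (simp add: tilde_def power_mult_distrib)
    ultimately have l2: "l (1 / (C * r)\<^sup>2) \<le> 2 * tilde l (r\<^sup>2)" by simp
    have "1 / (C * r)\<^sup>2 = (C * r) powr (- 2)" using elim \<open>0 < C\<close> by (simp add: powr_minus_divide)
    then have "(1 / (C * r)\<^sup>2) powr (\<alpha> / 2) = (C * r) powr (- \<alpha>)" by (simp only: powr_powr) simp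
    also have "\<dots> = C powr (- \<alpha>) * r powr (- \<alpha>)" by (rule powr_mult)
    finally have p: "(1 / (C * r)\<^sup>2) powr (\<alpha> / 2) = C powr (- \<alpha>) * r powr (- \<alpha>)" .
    have "\<Phi> (1 / (C * r)\<^sup>2) \<le> 2 * (C powr (- \<alpha>) * r powr (- \<alpha>) * l (1 / (C * r)\<^sup>2))"
      using elim(1) by (simp only: p)
    also have "\<dots> \<le> 2 * (C powr (- \<alpha>) * r powr (- \<alpha>) * (2 * tilde l (r\<^sup>2)))"
      using l2 by (intro mult_left_mono) auto
    finally show ?case by (simp add: mult_ac)
  qed
qed

text \<open>
  The radius \<open>R = C1 * norm x\<close> is the largest one for which the second difference bound is available.
  With it, small jumps and large jumps to the exterior both contribute \<open>\<Phi> (1 / R\<^sup>2)\<close> times the size of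
  \<open>\<phi> x\<close>, which the division by \<open>\<phi> x\<close> turns into the constant \<open>P\<close>. Large jumps into the central
  ball give the term with \<open>Q\<close>: a kernel of size \<open>\<Phi> (1 / R\<^sup>2)\<close> times \<open>norm x\<close> to the power \<open>- d\<close>, the
  mass \<open>I\<close>, and the reciprocal of \<open>\<phi> x\<close>.
\<close>

lemma potential_le_Bernstein_times_mass:
  fixes \<Phi> \<mu> :: "real \<Rightarrow> real"
    and V \<phi> L :: "'a::euclidean_space \<Rightarrow> real"
    and \<kappa> C1 C2 C3 C4 M M1 M2 :: real
  assumes B: "complete_Bernstein_pair \<Phi> \<mu>"
    and \<phi>: "\<phi> \<in> borel_measurable lebesgue" "\<And>x. 0 < \<phi> x"
    and V: "pointwise_potential \<mu> V \<phi>"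
    and "0 < C1" "Z_data C1 \<phi> M L" "0 < C2" "0 < C3" "0 < C4" "0 < M1" "0 < \<kappa>"
    and \<phi>_bounds: "\<And>x. M1 \<le> norm x \<Longrightarrow>
           C2 * norm x powr (- 2 * \<kappa>) \<le> \<phi> x \<and> \<phi> x \<le> C3 * norm x powr (- 2 * \<kappa>)"
    and L_bound: "\<And>x. M2 \<le> norm x \<Longrightarrow> L x \<le> C4 * norm x powr (- (2 * \<kappa> + 2))"
  obtains P Q where "0 \<le> P" "0 \<le> Q"
    "\<And>x I. \<lbrakk>M \<le> norm x; M1 \<le> norm x; M2 \<le> norm x; 0 \<le> I;
        (\<integral>\<^sup>+y. ennreal (\<phi> y) * indicator (ball 0 (norm x)) y \<partial>lebesgue) \<le> ennreal I\<rbrakk>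
      \<Longrightarrow> \<bar>V x\<bar> \<le> \<Phi> (1 / (C1 * norm x)\<^sup>2) * (P + Q * (norm x powr (2 * \<kappa> - real DIM('a)) * I))"
proof -
  let ?d = "DIM('a)"
  obtain G where G: "0 \<le> G" and moment: "\<And>\<Phi> \<mu> R. complete_Bernstein_pair \<Phi> \<mu> \<Longrightarrow> 0 < R \<Longrightarrow>
      (\<integral>\<^sup>+h. ennreal (min 1 ((norm (h::'a))\<^sup>2 / R\<^sup>2) * jump_kernel DIM('a) \<mu> (norm h)) \<partial>lborel)
        \<le> ennreal (G * \<Phi> (1 / R\<^sup>2))"
    using jump_kernel_truncated_moment[where ?'a = 'a] by blast
  define K :: real where "K = 2 * (4 ^ (?d + 1) * fact (?d + 1))"
  define P where "P = (C4 * C1\<^sup>2 + 4 * C3) * G / (2 * C2)"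
  define Q where "Q = K * C1 powr (- real ?d) / C2"
  have "\<bar>V x\<bar> \<le> \<Phi> (1 / (C1 * norm x)\<^sup>2) * (P + Q * (norm x powr (2 * \<kappa> - real ?d) * I))"
    if x: "M \<le> norm x" "M1 \<le> norm x" "M2 \<le> norm x" and "0 \<le> I"
      and mass: "(\<integral>\<^sup>+y. ennreal (\<phi> y) * indicator (ball 0 (norm x)) y \<partial>lebesgue) \<le> ennreal I" for x I
  proof -
    define r where "r = norm x"
    define R where "R = C1 * r"
    define p where "p = r powr (- 2 * \<kappa>)"
    define F where "F = \<Phi> (1 / R\<^sup>2)"
    define S where "S = K * R powr (- real ?d) * F"
    have r: "0 < r" using x(2) \<open>0 < M1\<close> unfolding r_def by linarith
    have R: "0 < R" using r \<open>0 < C1\<close> by (simp add: R_def)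
    have p: "0 < p" using r by (simp add: p_def)
    have F: "0 \<le> F" unfolding F_def using nn_integral_Bernstein(2)[OF B] R by simp
    have S: "0 \<le> S" using F by (simp add: S_def K_def)
    have "r powr (- (2 * \<kappa> + 2)) = p * r powr (- 2)" by (simp add: p_def flip: powr_add)
    also have "r powr (- 2) = C1\<^sup>2 / R\<^sup>2"
      using r \<open>0 < C1\<close> by (simp add: R_def powr_minus_divide power_mult_distrib)
    finally have Lr: "C4 * r powr (- (2 * \<kappa> + 2)) = C4 * C1\<^sup>2 * p / R\<^sup>2" by simp
    have near: "\<bar>second_difference h \<phi> x\<bar> \<le> C4 * C1\<^sup>2 * p * ((norm h)\<^sup>2 / R\<^sup>2)" if "norm h < R" for h
    proof -
      have "\<bar>second_difference h \<phi> x\<bar> \<le> L x * (norm h)\<^sup>2"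
        using \<open>Z_data C1 \<phi> M L\<close> x that by (simp add: Z_data_def R_def r_def)
      also have "\<dots> \<le> C4 * C1\<^sup>2 * p / R\<^sup>2 * (norm h)\<^sup>2"
        using L_bound[OF x(3), folded r_def, unfolded Lr] by (intro mult_right_mono) auto
      finally show ?thesis by simp
    qed
    have far: "\<phi> y \<le> C3 * p" if "r \<le> norm y" for y
    proof -
      have "\<phi> y \<le> C3 * norm y powr (- 2 * \<kappa>)" using \<phi>_bounds[of y] that x by (simp add: r_def)
      also have "\<dots> \<le> C3 * p"
        unfolding p_def using that r \<open>0 < \<kappa>\<close> \<open>0 < C3\<close> by (intro mult_left_mono powr_mono2') auto
      finally show ?thesis .
    qed
    have Jm: "(\<lambda>h::'a. jump_kernel ?d \<mu> (norm h)) \<in> borel_measurable borel"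
      using jump_kernel_measurable[OF B] by measurable
    have JS: "jump_kernel ?d \<mu> (norm h) \<le> S" if "R \<le> norm h" for h :: 'a
      unfolding S_def F_def K_def using jump_kernel_le_Bernstein[OF B R that] .
    have mom: "(\<integral>\<^sup>+h. ennreal (min 1 ((norm (h::'a))\<^sup>2 / R\<^sup>2) * jump_kernel ?d \<mu> (norm h)) \<partial>lborel) \<le> ennreal (G * F)"
      unfolding F_def by (rule moment[OF B R])
    let ?g = "\<lambda>h. second_difference h \<phi> x * jump_kernel ?d \<mu> (norm h)"
    have a0: "0 \<le> C4 * C1\<^sup>2 * p" using \<open>0 < C4\<close> p by simp
    have GF: "0 \<le> G * F" using G F by simp
    note bound = integral_second_difference_bound[OF \<phi>(1) less_imp_le[OF \<phi>(2)] Jm jump_kernel_nonneg[OF B]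
        R a0 S \<open>0 \<le> I\<close> GF near far[of x, unfolded r_def, OF order_refl] far JS mass[folded r_def] mom]
    have int: "integrable lebesgue ?g" by (rule bound(1))
    have "\<bar>LINT h|lebesgue. ?g h\<bar> \<le> (C4 * C1\<^sup>2 * p + 4 * (C3 * p)) * (G * F) + 2 * (S * I)"
      by (rule bound(2))
    also have "\<dots> = F * (2 * C2 * p * P + 2 * (K * R powr (- real ?d) * I))"
      using \<open>0 < C2\<close> by (simp add: P_def S_def field_simps)
    also have "K * R powr (- real ?d) * I = C2 * p * (Q * (r powr (2 * \<kappa> - real ?d) * I))"
    proof -
      have "p * r powr (2 * \<kappa> - real ?d) = r powr (- real ?d)"
        unfolding p_def by (simp flip: powr_add)
      moreover have "R powr (- real ?d) = C1 powr (- real ?d) * r powr (- real ?d)"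
        unfolding R_def by (rule powr_mult)
      ultimately have "K * R powr (- real ?d) = C2 * p * (Q * r powr (2 * \<kappa> - real ?d))"
        using \<open>0 < C2\<close> by (simp add: Q_def mult_ac)
      then show ?thesis by (simp add: mult_ac)
    qed
    finally have num: "\<bar>LINT h|lebesgue. ?g h\<bar> \<le> 2 * C2 * p * (F * (P + Q * (r powr (2 * \<kappa> - real ?d) * I)))"
      by (simp add: algebra_simps)
    have low: "2 * C2 * p \<le> 2 * \<phi> x" using \<phi>_bounds[OF x(2)] by (simp add: p_def r_def)
    have "\<bar>V x\<bar> = \<bar>LINT h|lebesgue. ?g h\<bar> / (2 * \<phi> x)"
      using V int \<phi>(2)[of x] by (simp add: pointwise_potential_def abs_mult)
    also have "\<dots> \<le> \<bar>LINT h|lebesgue. ?g h\<bar> / (2 * C2 * p)"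
      using low p \<open>0 < C2\<close> by (intro divide_left_mono) (auto intro: mult_pos_pos \<phi>(2))
    also have "\<dots> \<le> F * (P + Q * (r powr (2 * \<kappa> - real ?d) * I))"
      using num p \<open>0 < C2\<close> by (subst pos_divide_le_eq) (auto simp: mult_ac)
    finally show ?thesis by (simp add: F_def R_def r_def)
  qed
  moreover have "0 \<le> P" "0 \<le> Q" using G \<open>0 < C1\<close> \<open>0 < C2\<close> \<open>0 < C3\<close> \<open>0 < C4\<close> by (auto simp: P_def Q_def K_def)
  ultimately show thesis using that by blast
qed

theorem theorem4p3:
  fixes \<Phi> \<mu> l :: "real \<Rightarrow> real"
    and V \<phi> L :: "'a::euclidean_space \<Rightarrow> real"
    and \<alpha> \<kappa> C1 C2 C3 C4 M M1 M2 :: real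
  assumes "standing_assumption \<Phi> \<mu> V \<phi>"
    and "0 < C1" "C1 < 1" "\<phi> \<in> Z_space C1" "Z_data C1 \<phi> M L"
    and "0 < \<alpha>" "\<alpha> < 2"
    and "slowly_varying_at_zero l"
    and "\<Phi> \<sim>[at_right 0] (\<lambda>u. u powr (\<alpha> / 2) * l u)"
    and "0 < C2" "0 < C3" "0 < M1"
    and "0 < \<kappa>" "\<kappa> < (real DIM('a) + \<alpha>) / 2"
    and "\<And>x. x \<in> - ball 0 M1 \<Longrightarrow>
           C2 * norm x powr (- 2 * \<kappa>) \<le> \<phi> x \<and> \<phi> x \<le> C3 * norm x powr (- 2 * \<kappa>)"
    and "0 < M2" "0 < C4"
    and "\<And>x. x \<in> - ball 0 M2 \<Longrightarrow> L x \<le> C4 * norm x powr (- (2 * \<kappa> + 2))"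
  shows "(real DIM('a) / 2 < \<kappa> \<longrightarrow>
            V \<in> O[at_infinity](\<lambda>x. norm x powr (2 * \<kappa> - real DIM('a) - \<alpha>) * tilde l ((norm x)\<^sup>2)))
       \<and> (\<kappa> < real DIM('a) / 2 \<longrightarrow>
            V \<in> O[at_infinity](\<lambda>x. norm x powr (- \<alpha>) * tilde l ((norm x)\<^sup>2)))
       \<and> (\<kappa> = real DIM('a) / 2 \<longrightarrow>
            V \<in> O[at_infinity](\<lambda>x. norm x powr (- \<alpha>) * ln (norm x) * tilde l ((norm x)\<^sup>2)))"
proof -
  let ?d = "real DIM('a)"
  have B: "complete_Bernstein_pair \<Phi> \<mu>" and \<phi>pos: "\<And>x. 0 < \<phi> x" and V: "pointwise_potential \<mu> V \<phi>"
    using assms(1) by (auto simp: standing_assumption_def)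
  have "(\<lambda>x. complex_of_real (\<phi> x)) \<in> borel_measurable lebesgue"
    using assms(1) by (simp add: standing_assumption_def L2_fun_def)
  then have "(\<lambda>x. Re (complex_of_real (\<phi> x))) \<in> borel_measurable lebesgue" by measurable
  then have \<phi>m: "\<phi> \<in> borel_measurable lebesgue" by simp
  obtain b where bdd: "AE x in lebesgue. \<phi> x \<le> b"
  proof -
    obtain b where "AE x in lebesgue. \<bar>\<phi> x\<bar> \<le> b"
      using assms(1) unfolding standing_assumption_def Linf_on_def lebesgue_on_UNIV_eq by auto
    then have "AE x in lebesgue. \<phi> x \<le> b" by eventually_elim auto
    then show thesis by (rule that)
  qed
  have \<phi>_bounds: "C2 * norm x powr (- 2 * \<kappa>) \<le> \<phi> x \<and> \<phi> x \<le> C3 * norm x powr (- 2 * \<kappa>)" if "M1 \<le> norm x" for x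
    using assms(15) that by simp
  have decay: "\<phi> x \<le> C3 * norm x powr (- (2 * \<kappa>))" if "M1 \<le> norm x" for x
    using \<phi>_bounds[OF that] by simp
  have L_bound: "L x \<le> C4 * norm x powr (- (2 * \<kappa> + 2))" if "M2 \<le> norm x" for x
    using assms(18) that by simp
  have \<phi>0: "0 \<le> \<phi> x" for x using \<phi>pos less_imp_le by blast
  obtain P Q where PQ: "0 \<le> P" "0 \<le> Q"
    and V_le: "\<And>x I. \<lbrakk>M \<le> norm x; M1 \<le> norm x; M2 \<le> norm x; 0 \<le> I;
        (\<integral>\<^sup>+y. ennreal (\<phi> y) * indicator (ball 0 (norm x)) y \<partial>lebesgue) \<le> ennreal I\<rbrakk>
      \<Longrightarrow> \<bar>V x\<bar> \<le> \<Phi> (1 / (C1 * norm x)\<^sup>2) * (P + Q * (norm x powr (2 * \<kappa> - ?d) * I))"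
    using potential_le_Bernstein_times_mass[OF B \<phi>m \<phi>pos V assms(2,5,10,11,17,12,13) \<phi>_bounds L_bound] by blast
  define c where "c = 4 * C1 powr (- \<alpha>)"
  have c: "0 \<le> c" by (simp add: c_def)
  define w where "w x = norm x powr (- \<alpha>) * tilde l ((norm x)\<^sup>2)" for x :: 'a
  have ev_norm: "filterlim (norm :: 'a \<Rightarrow> real) at_top at_infinity" by (rule filterlim_norm_at_top)
  have \<Phi>_le: "\<forall>\<^sub>F x::'a in at_infinity. \<Phi> (1 / (C1 * norm x)\<^sup>2) \<le> c * w x"
    using eventually_compose_filterlim[OF Bernstein_at_inverse_square_le[OF assms(2,8,9)] ev_norm]
    by (simp add: c_def w_def)
  have large: "\<forall>\<^sub>F x::'a in at_infinity. N \<le> norm x" for N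
    using eventually_compose_filterlim[OF eventually_ge_at_top ev_norm] .
  (* It remains to bound the mass of \<phi> in balls: g is such a bound, and m is a function dominating
     both the constant term and the central-ball term of the estimate of V. *)
  have reduce: "V \<in> O[at_infinity](\<lambda>x. w x * m (norm x))"
    if K: "0 \<le> K" and mass: "\<And>\<rho>. M1 \<le> \<rho> \<Longrightarrow>
         (\<integral>\<^sup>+y. ennreal (\<phi> y) * indicator (ball 0 \<rho>) y \<partial>lebesgue) \<le> ennreal (g \<rho>)"
      and g: "\<And>\<rho>. M1 \<le> \<rho> \<Longrightarrow> 0 \<le> g \<rho>"
      and m: "\<And>\<rho>. N \<le> \<rho> \<Longrightarrow> 1 \<le> m \<rho> \<and> \<rho> powr (2 * \<kappa> - ?d) * g \<rho> \<le> K * m \<rho>"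
    for K N :: real and g m :: "real \<Rightarrow> real"
  proof (rule bigoI[where c = "c * (P + Q * K)"])
    show "\<forall>\<^sub>F x in at_infinity. norm (V x) \<le> c * (P + Q * K) * norm (w x * m (norm x))"
      using \<Phi>_le large[of 1] large[of M] large[of M1] large[of M2] large[of N]
    proof eventually_elim
      case (elim x)
      let ?I = "norm x powr (2 * \<kappa> - ?d) * g (norm x)"
      have m1: "1 \<le> m (norm x)" and mK: "?I \<le> K * m (norm x)" using m elim by auto
      have I: "0 \<le> ?I" using g elim by simp
      have w: "0 \<le> w x"
      proof -
        have "x \<noteq> 0" using elim(2) by auto
        then have "0 < l (1 / (norm x)\<^sup>2)" using assms(8) unfolding slowly_varying_at_zero_def by simp
        then show ?thesis by (simp add: w_def tilde_def)
      qed
      have "\<bar>V x\<bar> \<le> \<Phi> (1 / (C1 * norm x)\<^sup>2) * (P + Q * ?I)"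
        using V_le[of x "g (norm x)"] mass g elim by blast
      also have "\<dots> \<le> (c * w x) * (P * m (norm x) + Q * (K * m (norm x)))"
      proof (rule mult_mono)
        show "P + Q * ?I \<le> P * m (norm x) + Q * (K * m (norm x))"
          using PQ m1 mK by (intro add_mono mult_left_mono) (auto simp: mult_le_cancel_left1)
        show "0 \<le> P + Q * ?I" using PQ I by simp
      qed (use elim(1) c w in auto)
      also have "\<dots> = c * (P + Q * K) * (w x * m (norm x))" by (simp add: algebra_simps)
      also have "w x * m (norm x) = norm (w x * m (norm x))" using w m1 by simp
      finally show ?case by simp
    qed
  qed
  have C3: "0 \<le> C3" and s0: "0 \<le> 2 * \<kappa>" using assms by auto
  have "V \<in> O[at_infinity](\<lambda>x. norm x powr (2 * \<kappa> - ?d - \<alpha>) * tilde l ((norm x)\<^sup>2))" if "?d / 2 < \<kappa>"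
  proof -
    from that have s: "?d < 2 * \<kappa>" by simp
    obtain K where K: "0 \<le> K" "\<And>\<rho>. (\<integral>\<^sup>+y. ennreal (\<phi> y) * indicator (ball 0 \<rho>) y \<partial>lebesgue) \<le> ennreal K"
      using nn_integral_ball_fast_decay[OF \<phi>m \<phi>0 decay bdd assms(12) C3 s] by blast
    have "V \<in> O[at_infinity](\<lambda>x. w x * norm x powr (2 * \<kappa> - ?d))"
    proof (rule reduce[where N = 1 and g = "\<lambda>_. K"])
      fix \<rho> :: real assume "1 \<le> \<rho>"
      then show "1 \<le> \<rho> powr (2 * \<kappa> - ?d) \<and> \<rho> powr (2 * \<kappa> - ?d) * K \<le> K * \<rho> powr (2 * \<kappa> - ?d)"
        using s by (simp add: ge_one_powr_ge_zero)
    qed (use K in auto)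
    moreover have "w x * norm x powr (2 * \<kappa> - ?d) = norm x powr (2 * \<kappa> - ?d - \<alpha>) * tilde l ((norm x)\<^sup>2)" for x :: 'a
      using powr_add[of "norm x" "2 * \<kappa> - ?d" "- \<alpha>"] by (simp add: w_def mult_ac)
    ultimately show ?thesis by simp
  qed
  moreover have "V \<in> O[at_infinity](\<lambda>x. norm x powr (- \<alpha>) * tilde l ((norm x)\<^sup>2))" if "\<kappa> < ?d / 2"
  proof -
    from that have s: "2 * \<kappa> < ?d" by simp
    obtain K where K: "0 \<le> K" "\<And>\<rho>. M1 \<le> \<rho> \<Longrightarrow>
        (\<integral>\<^sup>+y. ennreal (\<phi> y) * indicator (ball 0 \<rho>) y \<partial>lebesgue) \<le> ennreal (K * \<rho> powr (?d - 2 * \<kappa>))"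
      using nn_integral_ball_slow_decay[OF \<phi>m \<phi>0 decay bdd assms(12) C3 s0 s] by blast
    have "V \<in> O[at_infinity](\<lambda>x. w x * 1)"
    proof (rule reduce[where N = 1 and m = "\<lambda>_. 1", OF K])
      fix \<rho> :: real assume "1 \<le> \<rho>"
      then show "1 \<le> (1::real) \<and> \<rho> powr (2 * \<kappa> - ?d) * (K * \<rho> powr (?d - 2 * \<kappa>)) \<le> K * 1"
        using powr_add[of \<rho> "2 * \<kappa> - ?d" "?d - 2 * \<kappa>"] by (simp add: mult.left_commute)
    qed (use K in auto)
    then show ?thesis by (simp add: w_def)
  qed
  moreover have "V \<in> O[at_infinity](\<lambda>x. norm x powr (- \<alpha>) * ln (norm x) * tilde l ((norm x)\<^sup>2))" if "\<kappa> = ?d / 2"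
  proof -
    from that have s: "2 * \<kappa> = ?d" by simp
    obtain K where K: "0 \<le> K" "\<And>\<rho>. M1 \<le> \<rho> \<Longrightarrow>
        (\<integral>\<^sup>+y. ennreal (\<phi> y) * indicator (ball 0 \<rho>) y \<partial>lebesgue) \<le> ennreal (K * (1 + ln (\<rho> / M1)))"
      using nn_integral_ball_critical_decay[OF \<phi>m \<phi>0 decay[unfolded s] bdd assms(12) C3] by blast
    have "V \<in> O[at_infinity](\<lambda>x. w x * ln (norm x))"
    (* From exp 1 on, the logarithm is at least 1 and absorbs the additive constants. *)
    proof (rule reduce[where N = "exp 1" and K = "K * (2 + \<bar>ln M1\<bar>)", OF _ K(2)])
      fix \<rho> :: real assume \<rho>: "exp 1 \<le> \<rho>"
      then have "0 < \<rho>" using exp_gt_zero[of "1::real"] by linarith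
      then have l1: "1 \<le> ln \<rho>" using \<rho> by (simp add: ln_ge_iff)
      have "1 + ln (\<rho> / M1) = 1 + ln \<rho> - ln M1" using \<open>0 < \<rho>\<close> assms(12) by (simp add: ln_div)
      also have "\<dots> \<le> ln \<rho> + ln \<rho> + \<bar>ln M1\<bar> * ln \<rho>"
        using l1 mult_left_mono[OF l1, of "\<bar>ln M1\<bar>"] by simp
      also have "\<dots> = (2 + \<bar>ln M1\<bar>) * ln \<rho>" by (simp add: algebra_simps)
      finally have "K * (1 + ln (\<rho> / M1)) \<le> K * ((2 + \<bar>ln M1\<bar>) * ln \<rho>)"
        using K(1) by (rule mult_left_mono)
      then show "1 \<le> ln \<rho> \<and> \<rho> powr (2 * \<kappa> - ?d) * (K * (1 + ln (\<rho> / M1))) \<le> K * (2 + \<bar>ln M1\<bar>) * ln \<rho>"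
        using l1 s \<open>0 < \<rho>\<close> by (simp add: mult.assoc)
    next
      fix \<rho> assume "M1 \<le> \<rho>"
      then show "0 \<le> K * (1 + ln (\<rho> / M1))"
        using K(1) assms(12) by simp
    qed (use K in auto)
    then show ?thesis by (simp add: w_def mult_ac)
  qed
  ultimately show ?thesis by blast
qed

end
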